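(* For every integer $p > 0$ and every integer $d \geq 5$, there exists a constant $C_p>0$ such that $M_{p,d}(n) \geq C_p n^{p/2+1/2}$ for all sufficiently large $n$.
   Context: For a finite set $S \subset \mathbb{R}^d$, the Vietoris–Rips complex $R(S)$ is the simplicial complex on vertex set $S$ whose faces are all subsets of $S$ of (Euclidean) diameter at most $1$. For a fixed field $\mathbf{k}$, $\tilde{\beta}_p(\Gamma)=\dim_{\mathbf{k}}\tilde{H}_p(\Gamma;\mathbf{k})$ denotes the $p$-th reduced Betti number. Define $M_{p,d}(n) := \max\{\tilde{\beta}_p(R(S)) : S \subset \mathbb{R}^d,\ |S| \leq n\}$. *)

theory Defs
  imports
    "HOL-Analysis.Abstract_Euclidean_Space"
    "HOL-Analysis.L2_Norm"
    "HOL-Combinatorics.Permutations"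
    "HOL-Algebra.AbelCoset"
    "Jordan_Normal_Form.VS_Connect"
begin

text \<open>
  Reduced simplicial homology with coefficients in a field. A simplicial complex is the set of
  its faces, the empty face included.

  An oriented chain is a finitely supported function on the orderings of the faces with \<open>m\<close>
  vertices (faces of dimension \<open>m - 1\<close>) that changes by the sign of the permutation when
  the vertices are reordered. Only orderings without repetition carry a value, so this is the
  usual space of oriented chains in every characteristic, including 2.
\<close>

definition oriented_chains :: "'v set set \<Rightarrow> nat \<Rightarrow> ('v list \<Rightarrow> 'k::field) set" where
  "oriented_chains K m =
     {c. finite {vs. c vs \<noteq> 0} \<and>
         (\<forall>vs. c vs \<noteq> 0 \<longrightarrow> distinct vs \<and> length vs = m \<and> set vs \<in> K) \<and>
         (\<forall>vs \<pi>. \<pi> permutes {..<length vs} \<longrightarrow>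
            c (permute_list \<pi> vs) = of_int (sign \<pi>) * c vs)}"

text \<open>
  The boundary \<open>\<partial>[v\<^sub>0,\<dots>,v\<^sub>q] = (\<Sum>i\<le>q. (-1)^i [v\<^sub>0,\<dots>,v\<^sub>i\<^sub>-\<^sub>1,v\<^sub>i\<^sub>+\<^sub>1,\<dots>,v\<^sub>q])\<close>, read off
  coefficientwise: the oriented simplex \<open>[y\<^sub>1,\<dots>,y\<^sub>q]\<close> arises from the simplices
  \<open>[v,y\<^sub>1,\<dots>,y\<^sub>q]\<close>, each time by deleting the leading vertex, hence with sign \<open>+1\<close>.
  For \<open>q = 0\<close> this is the augmentation, the coefficient of the empty face being the sum of the
  coefficients of the vertices.
\<close>

definition chain_boundary :: "('v list \<Rightarrow> 'k::field) \<Rightarrow> 'v list \<Rightarrow> 'k" where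
  "chain_boundary c = (\<lambda>vs. \<Sum>v | c (v # vs) \<noteq> 0. c (v # vs))"

definition simplicial_cycles :: "nat \<Rightarrow> 'v set set \<Rightarrow> ('v list \<Rightarrow> 'k::field) set" where
  "simplicial_cycles p K = {c \<in> oriented_chains K (p + 1). chain_boundary c = (\<lambda>_. 0)}"

definition simplicial_boundaries :: "nat \<Rightarrow> 'v set set \<Rightarrow> ('v list \<Rightarrow> 'k::field) set" where
  "simplicial_boundaries p K = chain_boundary ` oriented_chains K (p + 2)"

definition cycle_space :: "nat \<Rightarrow> 'v set set \<Rightarrow> ('k::field, 'v list \<Rightarrow> 'k) module" where
  "cycle_space p K =
     \<lparr>carrier = simplicial_cycles p K, monoid.mult = undefined, one = undefined,
      zero = (\<lambda>_. 0), add = (\<lambda>c c' vs. c vs + c' vs), module.smult = (\<lambda>a c vs. a * c vs)\<rparr>"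

definition quotient_module :: "('a, 'b, 'm) module_scheme \<Rightarrow> 'b set \<Rightarrow> ('a, 'b set) module" where
  "quotient_module M N =
     \<lparr>carrier = a_rcosets\<^bsub>M\<^esub> N, monoid.mult = undefined, one = undefined,
      zero = N, add = set_add M,
      module.smult = (\<lambda>a X. \<Union>x\<in>X. N +>\<^bsub>M\<^esub> (a \<odot>\<^bsub>M\<^esub> x))\<rparr>"

definition reduced_homology :: "nat \<Rightarrow> 'v set set \<Rightarrow> ('k::field, ('v list \<Rightarrow> 'k) set) module" where
  "reduced_homology p K = quotient_module (cycle_space p K) (simplicial_boundaries p K)"

definition reduced_betti :: "'k::field itself \<Rightarrow> nat \<Rightarrow> 'v set set \<Rightarrow> nat" where
  "reduced_betti _ p K =
     vectorspace.dim (class_ring :: 'k ring) (reduced_homology p K :: ('k, ('v list \<Rightarrow> 'k) set) module)"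

text \<open>
  Points of \<open>\<real>\<^sup>d\<close> are the elements of \<open>topspace (Euclidean_space d)\<close>, i.e. real sequences that
  vanish from index \<open>d\<close> on. This keeps \<open>d\<close> a number that can be quantified over.
\<close>

definition euclidean_dist :: "nat \<Rightarrow> (nat \<Rightarrow> real) \<Rightarrow> (nat \<Rightarrow> real) \<Rightarrow> real" where
  "euclidean_dist d x y = L2_set (\<lambda>i. x i - y i) {..<d}"

definition euclidean_diameter :: "nat \<Rightarrow> (nat \<Rightarrow> real) set \<Rightarrow> real" where
  "euclidean_diameter d A =
     (if A = {} then 0 else (SUP (x, y)\<in>A \<times> A. euclidean_dist d x y))"

definition vietoris_rips :: "nat \<Rightarrow> (nat \<Rightarrow> real) set \<Rightarrow> (nat \<Rightarrow> real) set set" where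
  "vietoris_rips d S = {\<sigma>. \<sigma> \<subseteq> S \<and> euclidean_diameter d \<sigma> \<le> 1}"

definition max_rips_betti :: "'k::field itself \<Rightarrow> nat \<Rightarrow> nat \<Rightarrow> nat \<Rightarrow> nat" where
  "max_rips_betti k p d n =
     Max {reduced_betti k p (vietoris_rips d S) | S.
            S \<subseteq> topspace (Euclidean_space d) \<and> finite S \<and> card S \<le> n}"

end

theory Submission
  imports Defs "HOL-Analysis.Complex_Transcendental"
begin

text \<open>
  The coefficient of a \<open>p\<close>-cycle at a maximal \<open>p\<close>-simplex depends only on its homology class. So
  \<open>\<beta>\<^sub>p\<close> is at least the number of maximal \<open>p\<close>-simplices \<open>v\<^sub>0,\<dots>,v\<^sub>p\<close> of a clique
  complex that can be completed by fixed vertices \<open>x\<^sub>0,\<dots>,x\<^sub>p\<close> to a cross-polytope with antipodal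
  pairs \<open>v\<^sub>s, x\<^sub>s\<close>.

  Such simplices are indexed by the \<open>m\<^sup>p\<^sup>+\<^sup>1\<close> functions \<open>f\<close> from the \<open>p + 1\<close> vertex types to
  \<open>{0..<m}\<close>. A vertex remembers only two values of \<open>f\<close>, so that about \<open>(p + 1) m\<^sup>2\<close> points suffice;
  since every value is remembered by two types, it is enough that vertices of different types are
  adjacent exactly if they agree on the values that both remember. For odd \<open>p\<close> the types come in
  pairs at the ends of diameters of a circle of diameter 1; the two ends of a diameter remember the
  same two values, and a perturbation orthogonal to the circle makes them adjacent exactly if these
  values agree. For even \<open>p\<close> there are in addition three types at the corners of an equilateral
  triangle of side 1 in an orthogonal plane; they remember \<open>(f\<^sub>0, f\<^sub>1)\<close>, \<open>(f\<^sub>1, f\<^sub>2)\<close>,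
  \<open>(f\<^sub>2, f\<^sub>0)\<close>, and each pair of them shares one value.
\<close>

section \<open>Subspaces and quotients of vector spaces\<close>

lemma subspaceI:
  assumes "vectorspace K V" "W \<subseteq> carrier V" "\<zero>\<^bsub>V\<^esub> \<in> W"
    and "\<And>v w. v \<in> W \<Longrightarrow> w \<in> W \<Longrightarrow> v \<oplus>\<^bsub>V\<^esub> w \<in> W"
    and "\<And>a v. a \<in> carrier K \<Longrightarrow> v \<in> W \<Longrightarrow> a \<odot>\<^bsub>V\<^esub> v \<in> W"
  shows "subspace K W V"
  using assms unfolding subspace_def submodule_def vectorspace_def by blast

lemma linear_mapI:
  assumes "vectorspace K V" "vectorspace K W" "T \<in> module_hom K V W"
  shows "linear_map K V W T"
  using assms unfolding linear_map_def mod_hom_def mod_hom_axioms_def vectorspace_def by blast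

lemma (in vectorspace) nested_subspace:
  assumes "subspace K U V" "subspace K W V" "U \<subseteq> W"
  shows "subspace K U (vs W)"
  using assms subspace_is_vs[OF assms(2)] by (auto simp: subspace_def submodule_def vectorspace_def)

lemma (in vectorspace) subspace_trans:
  assumes "subspace K W V" "subspace K U (vs W)"
  shows "subspace K U V"
  using assms vectorspace_axioms by (auto simp: subspace_def submodule_def)

lemma (in vectorspace) subspace_fin_dim:
  assumes fd: "fin_dim" and W: "subspace K W V"
  shows "vectorspace.fin_dim K (vs W)" "vectorspace.dim K (vs W) \<le> dim"
proof -
  interpret W: vectorspace K "vs W" by (rule subspace_is_vs[OF W])
  have WV: "W \<subseteq> carrier V" using is_module[OF W] by (simp add: submodule_def)
  have indpt: "finite A \<and> card A \<le> dim" if "A \<subseteq> W \<and> W.lin_indpt A" for A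
    using li_le_dim[OF fd, of A] span_li_not_depend(2)[of A W] that WV W by auto
  have "{} \<subseteq> W \<and> W.lin_indpt {}" by (simp add: W.lin_dep_def)
  from maximal_exists[where P = "\<lambda>A. A \<subseteq> W \<and> W.lin_indpt A", OF indpt this]
  obtain A where A: "finite A" "maximal A (\<lambda>A. A \<subseteq> W \<and> W.lin_indpt A)"
    by blast
  hence basis: "W.basis A" using W.max_li_is_basis by simp
  thus "W.fin_dim" unfolding W.fin_dim_def W.basis_def using A(1) by blast
  have "card A \<le> dim" using A(2) indpt by (simp add: maximal_def)
  thus "W.dim \<le> dim" using W.dim_basis[OF A(1) basis] by simp
qed

lemma (in linear_map) surj_dim_le:
  assumes "V.fin_dim" "T ` carrier V = carrier W"
  shows "W.dim \<le> V.dim"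
  using rank_nullity[OF assms(1)] surj_imp_imT_carrier[OF assms(2)] by simp

lemma (in linear_map) T_lincomb:
  assumes "finite A" "A \<subseteq> carrier V" "a \<in> A \<rightarrow> carrier K"
  shows "T (V.module.lincomb a A) = (\<Oplus>\<^bsub>W\<^esub>v\<in>A. a v \<odot>\<^bsub>W\<^esub> T v)"
proof -
  have "T (V.module.lincomb a A) = (\<Oplus>\<^bsub>W\<^esub>v\<in>A. T (a v \<odot>\<^bsub>V\<^esub> v))"
    unfolding V.module.lincomb_def using assms by (intro hom_sum) auto
  also have "\<dots> = (\<Oplus>\<^bsub>W\<^esub>v\<in>A. a v \<odot>\<^bsub>W\<^esub> T v)"
    using assms by (intro W.module.M.finsum_cong') (auto simp: Pi_iff subset_iff)
  finally show ?thesis .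
qed

context linear_map
begin

context
  fixes A
  assumes A: "finite A" "A \<subseteq> carrier V"
    and indpt: "\<And>a. a \<in> A \<rightarrow> carrier K \<Longrightarrow> V.module.lincomb a A \<in> kerT \<Longrightarrow> \<forall>v\<in>A. a v = \<zero>\<^bsub>K\<^esub>"
begin

lemma inj_on_if_indpt_mod_ker: "inj_on T A"
proof (rule inj_onI)
  fix v w assume vw: "v \<in> A" "w \<in> A" "T v = T w"
  hence carrier: "v \<in> carrier V" "w \<in> carrier V" using A(2) by auto
  have "v \<ominus>\<^bsub>V\<^esub> w \<in> V.module.span A"
    unfolding a_minus_def using vw(1,2) V.module.in_own_span[OF A(2)]
    by (intro V.span_add1[OF A(2)] V.span_neg[OF A(2)]) auto
  then obtain a where a: "a \<in> A \<rightarrow> carrier K" "v \<ominus>\<^bsub>V\<^esub> w = V.module.lincomb a A"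
    using V.module.finite_in_span[OF A] by metis
  moreover have "v \<ominus>\<^bsub>V\<^esub> w \<in> kerT"
    unfolding ker_def using carrier vw(3) by simp
  ultimately have "a \<in> A \<rightarrow> {\<zero>\<^bsub>K\<^esub>}" using indpt by (metis Pi_I singletonI)
  hence "v \<ominus>\<^bsub>V\<^esub> w = \<zero>\<^bsub>V\<^esub>" using a(2) V.lincomb_zero[OF A(2)] by simp
  thus "v = w" using carrier by simp
qed

lemma lin_indpt_image_if_indpt_mod_ker: "W.module.lin_indpt (T ` A)"
proof (rule W.module.finite_lin_indpt2)
  show "finite (T ` A)" using A(1) by (rule finite_imageI)
  show TA: "T ` A \<subseteq> carrier W" using A(2) f_im by blast
  fix a assume a: "a \<in> T ` A \<rightarrow> carrier K" "W.module.lincomb a (T ` A) = \<zero>\<^bsub>W\<^esub>"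
  have aT: "a \<circ> T \<in> A \<rightarrow> carrier K" unfolding Pi_iff o_apply using a(1) by blast
  have "(\<lambda>w. a w \<odot>\<^bsub>W\<^esub> w) \<in> T ` A \<rightarrow> carrier W"
    using W.module.smult_closed a(1) TA by (simp add: Pi_iff subset_iff)
  hence "W.module.lincomb a (T ` A) = (\<Oplus>\<^bsub>W\<^esub>v\<in>A. a (T v) \<odot>\<^bsub>W\<^esub> T v)"
    unfolding W.module.lincomb_def
    by (rule W.module.M.finsum_reindex[OF _ inj_on_if_indpt_mod_ker])
  hence "T (V.module.lincomb (a \<circ> T) A) = \<zero>\<^bsub>W\<^esub>"
    unfolding T_lincomb[OF A aT] o_apply using a(2) by argo
  hence "V.module.lincomb (a \<circ> T) A \<in> kerT"
    unfolding ker_def using V.module.lincomb_closed[OF A(2) aT] by blast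
  from indpt[OF aT this] show "\<forall>w\<in>T ` A. a w = \<zero>\<^bsub>K\<^esub>" unfolding o_apply by blast
qed

lemma card_le_dim_codomain:
  assumes "W.fin_dim"
  shows "card A \<le> W.dim"
proof -
  have "card (T ` A) \<le> W.dim"
    using A(2) f_im lin_indpt_image_if_indpt_mod_ker by (intro W.li_le_dim(2)[OF assms]) blast+
  thus ?thesis by (simp only: card_image[OF inj_on_if_indpt_mod_ker])
qed

end

end

context vectorspace
begin

context
  fixes N
  assumes N: "subspace K N V"
begin

lemma abelian_subgroup_subspace: "abelian_subgroup N V"
proof (rule abelian_subgroupI3)
  show "additive_subgroup N V"
  proof (intro additive_subgroup.intro group.subgroupI)
    fix v assume "v \<in> N"
    then show "inv\<^bsub>add_monoid V\<^esub> v \<in> N"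
      using is_module[OF N] smult_minus_1[of v] R.a_inv_closed[OF R.one_closed]
      unfolding submodule_def by (metis a_inv_def subsetD)
  qed (use is_module[OF N] in \<open>auto simp: submodule_def M.a_group\<close>)
qed (rule M.abelian_group_axioms)

interpretation abelian_subgroup N V by (rule abelian_subgroup_subspace)

lemma carrier_quotient_module: "carrier (quotient_module V N) = (\<lambda>v. N +>\<^bsub>V\<^esub> v) ` carrier V"
  by (auto simp: quotient_module_def A_RCOSETS_def')

lemma add_quotient_module:
  assumes "v \<in> carrier V" "w \<in> carrier V"
  shows "(N +>\<^bsub>V\<^esub> v) \<oplus>\<^bsub>quotient_module V N\<^esub> (N +>\<^bsub>V\<^esub> w) = N +>\<^bsub>V\<^esub> (v \<oplus>\<^bsub>V\<^esub> w)"
  using assms by (simp add: quotient_module_def a_rcos_sum)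

lemma smult_quotient_module:
  assumes a: "a \<in> carrier K" and v: "v \<in> carrier V"
  shows "a \<odot>\<^bsub>quotient_module V N\<^esub> (N +>\<^bsub>V\<^esub> v) = N +>\<^bsub>V\<^esub> (a \<odot>\<^bsub>V\<^esub> v)"
proof -
  have "N +>\<^bsub>V\<^esub> (a \<odot>\<^bsub>V\<^esub> w) = N +>\<^bsub>V\<^esub> (a \<odot>\<^bsub>V\<^esub> v)" if w: "w \<in> N +>\<^bsub>V\<^esub> v" for w
  proof -
    obtain n where n: "n \<in> N" "w = n \<oplus>\<^bsub>V\<^esub> v"
      using w by (auto simp: a_r_coset_def')
    hence "a \<odot>\<^bsub>V\<^esub> w = a \<odot>\<^bsub>V\<^esub> n \<oplus>\<^bsub>V\<^esub> a \<odot>\<^bsub>V\<^esub> v" "a \<odot>\<^bsub>V\<^esub> n \<in> N"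
      using is_module[OF N] a v by (auto simp: submodule_def smult_r_distr subsetD)
    hence "a \<odot>\<^bsub>V\<^esub> w \<in> N +>\<^bsub>V\<^esub> (a \<odot>\<^bsub>V\<^esub> v)" by (auto simp: a_r_coset_def')
    thus ?thesis using a_repr_independence'[of "a \<odot>\<^bsub>V\<^esub> w" "a \<odot>\<^bsub>V\<^esub> v"] a v by simp
  qed
  moreover have "N +>\<^bsub>V\<^esub> v \<noteq> {}" using a_rcos_self[OF v] by blast
  ultimately have "(\<Union>w\<in>N +>\<^bsub>V\<^esub> v. N +>\<^bsub>V\<^esub> (a \<odot>\<^bsub>V\<^esub> w)) = N +>\<^bsub>V\<^esub> (a \<odot>\<^bsub>V\<^esub> v)"
    by (intro SUP_eq_const)
  thus ?thesis by (simp add: quotient_module_def)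
qed

lemma zero_quotient_module: "\<zero>\<^bsub>quotient_module V N\<^esub> = N +>\<^bsub>V\<^esub> \<zero>\<^bsub>V\<^esub>"
  using a_subset by (simp add: quotient_module_def)

lemma abelian_group_quotient_module: "abelian_group (quotient_module V N)"
proof (rule abelian_groupI)
  fix X assume "X \<in> carrier (quotient_module V N)"
  then obtain v where v: "v \<in> carrier V" "X = N +>\<^bsub>V\<^esub> v" by (auto simp: carrier_quotient_module)
  hence "(N +>\<^bsub>V\<^esub> \<ominus>\<^bsub>V\<^esub> v) \<oplus>\<^bsub>quotient_module V N\<^esub> X = \<zero>\<^bsub>quotient_module V N\<^esub>"
    by (simp add: add_quotient_module zero_quotient_module M.l_neg)
  thus "\<exists>Y\<in>carrier (quotient_module V N). Y \<oplus>\<^bsub>quotient_module V N\<^esub> X = \<zero>\<^bsub>quotient_module V N\<^esub>"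
    using v by (auto simp: carrier_quotient_module)
qed (auto simp: carrier_quotient_module add_quotient_module zero_quotient_module
    M.a_assoc M.a_comm M.a_lcomm)

lemma vectorspace_quotient_module: "vectorspace K (quotient_module V N)"
proof -
  have "module K (quotient_module V N)"
    by (rule moduleI)
      (auto simp: carrier_quotient_module add_quotient_module smult_quotient_module
        abelian_group_quotient_module R.cring_axioms smult_l_distr smult_r_distr smult_assoc1)
  thus ?thesis using vectorspace_def field.field_axioms by blast
qed

lemma linear_map_quotient_module: "linear_map K V (quotient_module V N) (\<lambda>v. N +>\<^bsub>V\<^esub> v)"
proof -
  have "(\<lambda>v. N +>\<^bsub>V\<^esub> v) \<in> module_hom K V (quotient_module V N)"
    unfolding module_hom_def
    by (simp add: carrier_quotient_module add_quotient_module smult_quotient_module)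
  thus ?thesis
    by (rule linear_mapI[OF vectorspace_axioms vectorspace_quotient_module])
qed

lemma quotient_module_fin_dim:
  assumes "fin_dim"
  shows "vectorspace.fin_dim K (quotient_module V N)"
    and "vectorspace.dim K (quotient_module V N) \<le> dim"
proof -
  interpret Q: linear_map K V "quotient_module V N" "\<lambda>v. N +>\<^bsub>V\<^esub> v"
    by (rule linear_map_quotient_module)
  note surj = carrier_quotient_module[symmetric]
  show "Q.W.fin_dim" by (rule Q.surj_fin_dim[OF assms surj])
  show "Q.W.dim \<le> dim" by (rule Q.surj_dim_le[OF assms surj])
qed

lemma card_le_dim_quotient_module:
  assumes "fin_dim" "finite A" "A \<subseteq> carrier V"
    and indpt: "\<And>a. a \<in> A \<rightarrow> carrier K \<Longrightarrow> lincomb a A \<in> N \<Longrightarrow> \<forall>v\<in>A. a v = \<zero>\<^bsub>K\<^esub>"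
  shows "card A \<le> vectorspace.dim K (quotient_module V N)"
proof -
  interpret Q: linear_map K V "quotient_module V N" "\<lambda>v. N +>\<^bsub>V\<^esub> v"
    by (rule linear_map_quotient_module)
  have "v \<in> N" if "v \<in> Q.kerT" for v
    using that a_rcos_self[of v] unfolding Q.ker_def by (simp add: quotient_module_def)
  thus ?thesis
    using assms by (intro Q.card_le_dim_codomain quotient_module_fin_dim) auto
qed

end

end

section \<open>Spaces of functions\<close>

definition fun_space :: "'x set \<Rightarrow> ('k::field, 'x \<Rightarrow> 'k) module" where
  "fun_space L =
     \<lparr>carrier = {c. \<forall>x. x \<notin> L \<longrightarrow> c x = 0}, monoid.mult = undefined, one = undefined,
      zero = (\<lambda>_. 0), add = (\<lambda>c c' x. c x + c' x), module.smult = (\<lambda>a c x. a * c x)\<rparr>"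

lemma fun_space_simps [simp]:
  "carrier (fun_space L) = {c. \<forall>x. x \<notin> L \<longrightarrow> c x = 0}"
  "\<zero>\<^bsub>fun_space L\<^esub> = (\<lambda>_. 0)"
  "c \<oplus>\<^bsub>fun_space L\<^esub> c' = (\<lambda>x. c x + c' x)"
  "a \<odot>\<^bsub>fun_space L\<^esub> c = (\<lambda>x. a * c x)"
  by (simp_all add: fun_space_def)

lemma vectorspace_fun_space: "vectorspace class_ring (fun_space L)"
proof -
  have "module class_ring (fun_space L)"
  proof (rule moduleI)
    show "abelian_group (fun_space L)"
    proof (rule abelian_groupI)
      fix c assume "c \<in> carrier (fun_space L)"
      thus "\<exists>c'\<in>carrier (fun_space L). c' \<oplus>\<^bsub>fun_space L\<^esub> c = \<zero>\<^bsub>fun_space L\<^esub>"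
        by (intro bexI[of _ "\<lambda>x. - c x"]) auto
    qed (auto simp: algebra_simps)
  qed (auto simp: algebra_simps class_cring.is_cring)
  thus ?thesis unfolding vectorspace_def using class_field by blast
qed

interpretation fun_space: vectorspace class_ring "fun_space L"
  by (rule vectorspace_fun_space)

lemma lincomb_fun_space:
  assumes "finite A" "A \<subseteq> carrier (fun_space L)"
  shows "fun_space.lincomb L a A = (\<lambda>x. \<Sum>c\<in>A. a c * c x)"
  using assms
proof (induction A rule: finite_induct)
  case (insert c A)
  have "fun_space.lincomb L a (insert c A) =
      a c \<odot>\<^bsub>fun_space L\<^esub> c \<oplus>\<^bsub>fun_space L\<^esub> fun_space.lincomb L a A"
    using insert by (intro fun_space.lincomb_insert2) auto
  then show ?case using insert by simp
qed simp

lemma fun_space_fin_dim: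
  assumes L: "finite L"
  shows "vectorspace.fin_dim class_ring (fun_space L :: ('k::field, 'x \<Rightarrow> 'k) module)"
    and "vectorspace.dim class_ring (fun_space L :: ('k, 'x \<Rightarrow> 'k) module) \<le> card L"
proof -
  define \<delta> :: "'x \<Rightarrow> 'x \<Rightarrow> 'k" where "\<delta> y x = of_bool (x = y)" for x y
  have \<delta>: "\<delta> ` L \<subseteq> carrier (fun_space L)" by (auto simp: \<delta>_def)
  have inj: "inj_on \<delta> L" by (rule inj_onI) (metis \<delta>_def of_bool_eq_1_iff)
  have "c \<in> fun_space.span L (\<delta> ` L)" if c: "c \<in> carrier (fun_space L)" for c :: "'x \<Rightarrow> 'k"
  proof -
    have "c = fun_space.lincomb L (\<lambda>d. c (inv_into L \<delta> d)) (\<delta> ` L)"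
    proof
      fix x
      have "fun_space.lincomb L (\<lambda>d. c (inv_into L \<delta> d)) (\<delta> ` L) x = (\<Sum>y\<in>L. c y * \<delta> y x)"
        using L \<delta> by (simp add: lincomb_fun_space sum.reindex[OF inj] inv_into_f_f[OF inj])
      also have "\<dots> = c x"
        using L c by (cases "x \<in> L") (auto simp: \<delta>_def)
      finally show "c x = fun_space.lincomb L (\<lambda>d. c (inv_into L \<delta> d)) (\<delta> ` L) x" ..
    qed
    thus ?thesis
      unfolding fun_space.finite_span[OF finite_imageI[OF L] \<delta>]
      by (intro CollectI exI conjI) (assumption, simp)
  qed
  hence gen: "fun_space.gen_set L (\<delta> ` L)"
    using fun_space.span_is_subset2[OF \<delta>] by blast
  thus "vectorspace.fin_dim class_ring (fun_space L :: ('k, _) module)"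
    unfolding fun_space.fin_dim_def using L \<delta> by blast
  show "vectorspace.dim class_ring (fun_space L :: ('k, _) module) \<le> card L"
    using fun_space.gen_ge_dim[OF _ \<delta> gen] L card_image_le[OF L, of \<delta>] by simp
qed

section \<open>Oriented chains of a finite complex\<close>

lemma oriented_chainsD:
  assumes "c \<in> oriented_chains K m"
  shows "c vs \<noteq> 0 \<Longrightarrow> distinct vs" "c vs \<noteq> 0 \<Longrightarrow> length vs = m" "c vs \<noteq> 0 \<Longrightarrow> set vs \<in> K"
    "\<pi> permutes {..<length vs} \<Longrightarrow> c (permute_list \<pi> vs) = of_int (sign \<pi>) * c vs"
  using assms unfolding oriented_chains_def by blast+

lemma boundary_eq_0_at_maximal_face:
  assumes "b \<in> simplicial_boundaries p K" and maximal: "\<And>w. insert w (set vs) \<in> K \<Longrightarrow> w \<in> set vs"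
  shows "b vs = 0"
proof -
  obtain c where c: "c \<in> oriented_chains K (p + 2)" and b: "b = chain_boundary c"
    using assms(1) by (auto simp: simplicial_boundaries_def)
  have "c (w # vs) = 0" for w
    using oriented_chainsD(1,3)[OF c, of "w # vs"] maximal by auto
  thus ?thesis by (simp add: b chain_boundary_def)
qed

locale finite_complex =
  fixes S :: "'v set" and K :: "'v set set"
  assumes finite_S: "finite S" and faces: "\<And>\<sigma>. \<sigma> \<in> K \<Longrightarrow> \<sigma> \<subseteq> S"
    and down_closed: "\<And>\<sigma> \<tau>. \<sigma> \<in> K \<Longrightarrow> \<tau> \<subseteq> \<sigma> \<Longrightarrow> \<tau> \<in> K"
begin

abbreviation vertex_lists :: "nat \<Rightarrow> 'v list set" where
  "vertex_lists m \<equiv> {vs. set vs \<subseteq> S \<and> length vs = m}"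

definition chain_space :: "nat \<Rightarrow> ('k::field, 'v list \<Rightarrow> 'k) module" where
  "chain_space m = (fun_space (vertex_lists m))\<lparr>carrier := oriented_chains K m\<rparr>"

lemma chain_space_simps [simp]:
  "carrier (chain_space m) = oriented_chains K m"
  "\<zero>\<^bsub>chain_space m\<^esub> = (\<lambda>_. 0)"
  "c \<oplus>\<^bsub>chain_space m\<^esub> c' = (\<lambda>vs. c vs + c' vs)"
  "a \<odot>\<^bsub>chain_space m\<^esub> c = (\<lambda>vs. a * c vs)"
  by (simp_all add: chain_space_def fun_space_def)

lemma oriented_chainsI:
  fixes c :: "'v list \<Rightarrow> 'k::field"
  assumes "\<And>vs. c vs \<noteq> 0 \<Longrightarrow> distinct vs \<and> length vs = m \<and> set vs \<in> K"
    and "\<And>vs \<pi>. \<pi> permutes {..<length vs} \<Longrightarrow> c (permute_list \<pi> vs) = of_int (sign \<pi>) * c vs"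
  shows "c \<in> oriented_chains K m"
proof -
  have "{vs. c vs \<noteq> 0} \<subseteq> vertex_lists m" using assms(1) faces by blast
  hence "finite {vs. c vs \<noteq> 0}"
    by (rule finite_subset) (rule finite_lists_length_eq[OF finite_S])
  thus ?thesis unfolding oriented_chains_def using assms by blast
qed

lemma subspace_oriented_chains:
  "subspace class_ring (oriented_chains K m) (fun_space (vertex_lists m))"
proof (rule subspaceI[OF vectorspace_fun_space])
  show "oriented_chains K m \<subseteq> carrier (fun_space (vertex_lists m) :: ('k::field, _) module)"
    using oriented_chainsD(2,3) faces by fastforce
next
  fix c c' :: "'v list \<Rightarrow> 'k::field"
  assume c: "c \<in> oriented_chains K m" and c': "c' \<in> oriented_chains K m"
  have "(\<lambda>vs. c vs + c' vs) \<in> oriented_chains K m"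
  proof (rule oriented_chainsI)
    fix vs assume "c vs + c' vs \<noteq> 0"
    hence "c vs \<noteq> 0 \<or> c' vs \<noteq> 0" by auto
    thus "distinct vs \<and> length vs = m \<and> set vs \<in> K"
      using oriented_chainsD(1-3)[OF c, of vs] oriented_chainsD(1-3)[OF c', of vs] by blast
  qed (simp add: oriented_chainsD(4)[OF c] oriented_chainsD(4)[OF c'] algebra_simps)
  thus "c \<oplus>\<^bsub>fun_space (vertex_lists m)\<^esub> c' \<in> oriented_chains K m" by simp
next
  fix a and c :: "'v list \<Rightarrow> 'k::field" assume c: "c \<in> oriented_chains K m"
  have "(\<lambda>vs. a * c vs) \<in> oriented_chains K m"
  proof (rule oriented_chainsI)
    fix vs assume "a * c vs \<noteq> 0"
    thus "distinct vs \<and> length vs = m \<and> set vs \<in> K"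
      using oriented_chainsD(1-3)[OF c, of vs] by auto
  qed (simp add: oriented_chainsD(4)[OF c] algebra_simps)
  thus "a \<odot>\<^bsub>fun_space (vertex_lists m)\<^esub> c \<in> oriented_chains K m" by simp
qed (auto intro!: oriented_chainsI)

lemma vectorspace_chain_space: "vectorspace class_ring (chain_space m)"
  unfolding chain_space_def by (rule fun_space.subspace_is_vs[OF subspace_oriented_chains])

lemma chain_boundary_eq_sum:
  assumes "c \<in> oriented_chains K m"
  shows "chain_boundary c vs = (\<Sum>v\<in>S. c (v # vs))"
  unfolding chain_boundary_def
proof (rule sum.mono_neutral_left)
  show "{v. c (v # vs) \<noteq> 0} \<subseteq> S"
    using oriented_chainsD(3)[OF assms] faces by fastforce
qed (auto simp: finite_S)

end

text \<open>In characteristic 2 antisymmetry alone does not kill the diagonal terms.\<close>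

lemma sum_antisymmetric:
  fixes g :: "'a \<Rightarrow> 'a \<Rightarrow> 'b::ab_group_add"
  assumes "finite A" "\<And>x y. g x y = - g y x" "\<And>x. g x x = 0"
  shows "(\<Sum>x\<in>A. \<Sum>y\<in>A. g x y) = 0"
  using assms(1)
proof (induction A rule: finite_induct)
  case (insert a A)
  have "(\<Sum>x\<in>A. g x a) = - (\<Sum>x\<in>A. g a x)"
    by (subst assms(2)) (simp add: sum_negf)
  then show ?case using insert by (simp add: assms(3) sum.distrib)
qed simp

lemma permute_list_Cons:
  assumes "\<pi> permutes {..<length vs}"
  obtains \<pi>' where "\<pi>' permutes {..<length (v # vs)}" "sign \<pi>' = sign \<pi>"
    "permute_list \<pi>' (v # vs) = v # permute_list \<pi> vs"
proof -
  define \<pi>' where "\<pi>' = map_permutation {..<length vs} Suc \<pi>"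
  have p: "\<pi>' permutes Suc ` {..<length vs}"
    unfolding \<pi>'_def by (intro map_permutation_permutes assms inj_on_imp_bij_betw) simp
  show ?thesis
  proof
    show p': "\<pi>' permutes {..<length (v # vs)}" by (rule permutes_subset[OF p]) auto
    show "sign \<pi>' = sign \<pi>" unfolding \<pi>'_def by (intro sign_map_permutation assms) auto
    have "\<pi>' 0 = 0" by (rule permutes_not_in[OF p]) auto
    moreover have "\<pi>' (Suc i) = Suc (\<pi> i)" if "i < length vs" for i
      unfolding \<pi>'_def using that by (intro map_permutation_apply) auto
    ultimately show "permute_list \<pi>' (v # vs) = v # permute_list \<pi> vs"
      using permute_list_nth[OF p'] permute_list_nth[OF assms]
      by (intro nth_equalityI) (auto simp: nth_Cons split: nat.splits)
  qed
qed

lemma oriented_chain_swap: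
  assumes "c \<in> oriented_chains K m"
  shows "c (v # w # vs) = - c (w # v # vs)"
proof -
  let ?t = "Transposition.transpose (0::nat) 1"
  have t: "?t permutes {..<length (w # v # vs)}"
    by (rule permutes_swap_id) auto
  have "permute_list ?t (w # v # vs) = v # w # vs"
  proof (rule nth_equalityI)
    fix i assume "i < length (permute_list ?t (w # v # vs))"
    thus "permute_list ?t (w # v # vs) ! i = (v # w # vs) ! i"
      by (subst permute_list_nth[OF t])
        (auto simp: Transposition.transpose_def nth_Cons split: nat.splits)
  qed simp
  with oriented_chainsD(4)[OF assms t] show ?thesis by (simp add: sign_swap_id)
qed

context finite_complex
begin

lemma chain_boundary_closed:
  fixes c :: "'v list \<Rightarrow> 'k::field"
  assumes c: "c \<in> oriented_chains K (Suc m)"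
  shows "chain_boundary c \<in> oriented_chains K m"
proof (rule oriented_chainsI)
  fix vs assume "chain_boundary c vs \<noteq> 0"
  then obtain v where "c (v # vs) \<noteq> 0"
    unfolding chain_boundary_eq_sum[OF c] by (metis (mono_tags, lifting) sum.neutral)
  from oriented_chainsD(1-3)[OF c this] show "distinct vs \<and> length vs = m \<and> set vs \<in> K"
    using down_closed[of "set (v # vs)" "set vs"] by auto
next
  fix vs \<pi> assume \<pi>: "\<pi> permutes {..<length (vs :: 'v list)}"
  have "c (v # permute_list \<pi> vs) = of_int (sign \<pi>) * c (v # vs)" for v
    using permute_list_Cons[OF \<pi>, of v] oriented_chainsD(4)[OF c] by metis
  thus "chain_boundary c (permute_list \<pi> vs) = of_int (sign \<pi>) * chain_boundary c vs"
    by (simp add: chain_boundary_eq_sum[OF c] sum_distrib_left)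
qed

lemma chain_boundary_boundary:
  fixes c :: "'v list \<Rightarrow> 'k::field"
  assumes c: "c \<in> oriented_chains K (Suc m)"
  shows "chain_boundary (chain_boundary c) = (\<lambda>_. 0)"
proof
  fix vs
  have "c (v # v # vs) = 0" for v using oriented_chainsD(1)[OF c, of "v # v # vs"] by auto
  with oriented_chain_swap[OF c] have "(\<Sum>w\<in>S. \<Sum>v\<in>S. c (v # w # vs)) = 0"
    by (intro sum_antisymmetric finite_S)
  thus "chain_boundary (chain_boundary c) vs = 0"
    by (simp add: chain_boundary_eq_sum[OF chain_boundary_closed[OF c]] chain_boundary_eq_sum[OF c])
qed

lemma linear_map_chain_boundary:
  "linear_map class_ring (chain_space (Suc m)) (chain_space m)
     (chain_boundary :: ('v list \<Rightarrow> 'k::field) \<Rightarrow> _)"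
proof (rule linear_mapI[OF vectorspace_chain_space vectorspace_chain_space])
  interpret C: vectorspace class_ring "chain_space (Suc m) :: ('k, _) module"
    by (rule vectorspace_chain_space)
  have "chain_boundary (\<lambda>vs. c vs + c' vs) = (\<lambda>vs. chain_boundary c vs + chain_boundary c' vs)"
    if c: "c \<in> oriented_chains K (Suc m)" "c' \<in> oriented_chains K (Suc m)" for c c' :: "'v list \<Rightarrow> 'k"
  proof -
    have "(\<lambda>vs. c vs + c' vs) \<in> oriented_chains K (Suc m)" using C.M.a_closed c by simp
    with c show ?thesis by (simp add: fun_eq_iff chain_boundary_eq_sum[of _ "Suc m"] sum.distrib)
  qed
  moreover have "chain_boundary (\<lambda>vs. a * c vs) = (\<lambda>vs. a * chain_boundary c vs)"
    if c: "c \<in> oriented_chains K (Suc m)" for a and c :: "'v list \<Rightarrow> 'k"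
  proof -
    have "(\<lambda>vs. a * c vs) \<in> oriented_chains K (Suc m)" using C.smult_closed[of a c] c by simp
    with c show ?thesis
      by (simp add: fun_eq_iff chain_boundary_eq_sum[of _ "Suc m"] sum_distrib_left)
  qed
  ultimately show
    "chain_boundary \<in> module_hom class_ring (chain_space (Suc m)) (chain_space m :: ('k, _) module)"
    by (auto simp: module_hom_def chain_boundary_closed)
qed

lemma subspace_cycles:
  "subspace class_ring (simplicial_cycles p K)
     (fun_space (vertex_lists (Suc p)) :: ('k::field, _) module)"
proof -
  interpret linear_map class_ring "chain_space (Suc p) :: ('k, _) module" "chain_space p"
      chain_boundary
    by (rule linear_map_chain_boundary)
  have "simplicial_cycles p K = kerT" by (simp add: simplicial_cycles_def ker_def)
  thus ?thesis
    using fun_space.subspace_trans[OF subspace_oriented_chains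
        kerT_is_subspace[unfolded chain_space_def]]
    by (simp add: chain_space_def)
qed

lemma subspace_boundaries:
  "subspace class_ring (simplicial_boundaries p K)
     (fun_space (vertex_lists (Suc p)) :: ('k::field, _) module)"
proof -
  interpret linear_map class_ring "chain_space (Suc (Suc p)) :: ('k, _) module" "chain_space (Suc p)"
      chain_boundary
    by (rule linear_map_chain_boundary)
  have "simplicial_boundaries p K = imT" by (simp add: simplicial_boundaries_def im_def)
  thus ?thesis
    using fun_space.subspace_trans[OF subspace_oriented_chains
        imT_is_subspace[unfolded chain_space_def]]
    by (simp add: chain_space_def)
qed

lemma boundaries_subset_cycles:
  "simplicial_boundaries p K \<subseteq> (simplicial_cycles p K :: ('v list \<Rightarrow> 'k::field) set)"
  using chain_boundary_closed[of _ "p + 1"] chain_boundary_boundary[of _ "p + 1"]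
  by (auto simp: simplicial_boundaries_def simplicial_cycles_def)

lemma cycle_space_eq:
  "cycle_space p K = (fun_space (vertex_lists (Suc p)))\<lparr>carrier := simplicial_cycles p K\<rparr>"
  by (simp add: cycle_space_def fun_space_def)

lemma vectorspace_cycle_space: "vectorspace class_ring (cycle_space p K)"
  unfolding cycle_space_eq by (rule fun_space.subspace_is_vs[OF subspace_cycles])

lemma subspace_boundaries_cycle_space:
  "subspace class_ring (simplicial_boundaries p K) (cycle_space p K)"
  unfolding cycle_space_eq
  by (rule fun_space.nested_subspace[OF subspace_boundaries subspace_cycles boundaries_subset_cycles])

lemma lincomb_cycle_space:
  assumes "finite A" "A \<subseteq> simplicial_cycles p K"
  shows "module.lincomb (cycle_space p K) a A = (\<lambda>vs. \<Sum>c\<in>A. a c * c vs)"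
proof -
  have "A \<subseteq> carrier (fun_space (vertex_lists (Suc p)))"
    using assms(2) subspace_cycles[of p] unfolding subspace_def submodule_def by blast
  thus ?thesis
    using assms fun_space.lincomb_not_depend[OF assms fun_space.is_module[OF subspace_cycles], of a]
    by (simp add: cycle_space_eq lincomb_fun_space)
qed

lemma cycle_space_fin_dim:
  shows "vectorspace.fin_dim class_ring (cycle_space p K :: ('k::field, _) module)"
    and "vectorspace.dim class_ring (cycle_space p K :: ('k, _) module) \<le> card S ^ Suc p"
proof -
  have "finite (vertex_lists (Suc p))" by (rule finite_lists_length_eq[OF finite_S])
  note fin_dim = fun_space_fin_dim[OF this, where ?'k = 'k]
  note cycles = fun_space.subspace_fin_dim[OF fin_dim(1) subspace_cycles, folded cycle_space_eq]
  show "vectorspace.fin_dim class_ring (cycle_space p K :: ('k, _) module)" by (rule cycles(1))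
  show "vectorspace.dim class_ring (cycle_space p K :: ('k, _) module) \<le> card S ^ Suc p"
    using cycles(2) fin_dim(2) unfolding card_lists_length_eq[OF finite_S] by (rule order_trans)
qed

lemma reduced_betti_le: "reduced_betti TYPE('k::field) p K \<le> card S ^ Suc p"
  using vectorspace.quotient_module_fin_dim(2)[OF vectorspace_cycle_space
      subspace_boundaries_cycle_space cycle_space_fin_dim(1)] cycle_space_fin_dim(2)
  unfolding reduced_betti_def reduced_homology_def by (rule order_trans)

lemma card_le_reduced_betti:
  fixes z :: "'i \<Rightarrow> 'v list \<Rightarrow> 'k::field"
  assumes I: "finite I" and z: "\<And>i. i \<in> I \<Longrightarrow> z i \<in> simplicial_cycles p K"
    and maximal: "\<And>i w. i \<in> I \<Longrightarrow> insert w (set (y i)) \<in> K \<Longrightarrow> w \<in> set (y i)"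
    and dual: "\<And>i j. i \<in> I \<Longrightarrow> j \<in> I \<Longrightarrow> z i (y j) = (if i = j then 1 else 0)"
  shows "card I \<le> reduced_betti TYPE('k) p K"
proof -
  have inj: "inj_on z I" using dual by (intro inj_onI) (metis zero_neq_one)
  have "card (z ` I) \<le> vectorspace.dim class_ring
      (quotient_module (cycle_space p K) (simplicial_boundaries p K :: ('v list \<Rightarrow> 'k) set))"
  proof (rule vectorspace.card_le_dim_quotient_module[OF vectorspace_cycle_space
        subspace_boundaries_cycle_space cycle_space_fin_dim(1)])
    fix a assume lc: "module.lincomb (cycle_space p K) a (z ` I) \<in> simplicial_boundaries p K"
    have "a (z j) = 0" if j: "j \<in> I" for j
    proof -
      have "module.lincomb (cycle_space p K) a (z ` I) (y j) = (\<Sum>i\<in>I. a (z i) * z i (y j))"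
        using I z by (subst lincomb_cycle_space) (auto simp: sum.reindex[OF inj])
      also have "\<dots> = (\<Sum>i\<in>I. if i = j then a (z i) else 0)"
        using dual j by (intro sum.cong) auto
      also have "\<dots> = a (z j)" using I j by simp
      finally show ?thesis using boundary_eq_0_at_maximal_face[OF lc maximal[OF j]] by simp
    qed
    thus "\<forall>c\<in>z ` I. a c = \<zero>\<^bsub>class_ring\<^esub>" by simp
  qed (use I z in \<open>auto simp: cycle_space_def\<close>)
  thus ?thesis
    by (simp add: reduced_betti_def reduced_homology_def card_image[OF inj])
qed

end

section \<open>Cross-polytopes in clique complexes\<close>

definition cross_matrix :: "nat \<Rightarrow> (nat \<Rightarrow> 'v) \<Rightarrow> (nat \<Rightarrow> 'v) \<Rightarrow> 'v list \<Rightarrow> 'k::field mat" where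
  "cross_matrix n v x vs = mat n n (\<lambda>(r, s). of_bool (vs ! r = v s) - of_bool (vs ! r = x s))"

text \<open>The join of the 0-spheres \<open>v s - x s\<close>, i.e. their product in the exterior algebra.\<close>

definition cross_polytope_chain :: "nat \<Rightarrow> (nat \<Rightarrow> 'v) \<Rightarrow> (nat \<Rightarrow> 'v) \<Rightarrow> 'v list \<Rightarrow> 'k::field" where
  "cross_polytope_chain n v x vs = (if length vs = n then det (cross_matrix n v x vs) else 0)"

lemma cross_matrix_carrier [simp]: "cross_matrix n v x vs \<in> carrier_mat n n"
  by (simp add: cross_matrix_def)

lemma cross_polytope_chain_support:
  assumes "cross_polytope_chain n v x vs \<noteq> (0::'k::field)"
  obtains \<pi> where "\<pi> permutes {..<n}" "length vs = n" "\<And>r. r < n \<Longrightarrow> vs ! r \<in> {v (\<pi> r), x (\<pi> r)}"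
proof -
  have n: "length vs = n" and "det (cross_matrix n v x vs :: 'k mat) \<noteq> 0"
    using assms by (auto simp: cross_polytope_chain_def split: if_splits)
  then obtain \<pi> where \<pi>: "\<pi> permutes {..<n}"
    and nz: "signof \<pi> * (\<Prod>r = 0..<n. (cross_matrix n v x vs :: 'k mat) $$ (r, \<pi> r)) \<noteq> 0"
    unfolding det_def'[OF cross_matrix_carrier] lessThan_atLeast0
    by (metis (mono_tags, lifting) mem_Collect_eq sum.neutral)
  have "vs ! r \<in> {v (\<pi> r), x (\<pi> r)}" if "r < n" for r
  proof -
    have "(cross_matrix n v x vs :: 'k mat) $$ (r, \<pi> r) \<noteq> 0" using nz that by auto
    moreover have "\<pi> r < n" using permutes_in_image[OF \<pi>, of r] that by simp
    ultimately show ?thesis using that by (auto simp: cross_matrix_def split: if_splits)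
  qed
  with \<pi> n show ?thesis using that by blast
qed

lemma cross_polytope_chain_distinct:
  assumes "cross_polytope_chain n v x vs \<noteq> (0::'k::field)"
  shows "distinct vs"
proof (rule ccontr)
  assume "\<not> distinct vs"
  then obtain i j where ij: "i < length vs" "j < length vs" "i \<noteq> j" "vs ! i = vs ! j"
    by (auto simp: distinct_conv_nth)
  have n: "length vs = n" using assms by (auto simp: cross_polytope_chain_def split: if_splits)
  have "det (cross_matrix n v x vs :: 'k mat) = 0"
    using ij n by (intro det_identical_rows[OF _ ij(3)]) (auto simp: cross_matrix_def)
  thus False using assms n unfolding cross_polytope_chain_def by simp
qed

lemma cross_polytope_chain_permute:
  assumes \<pi>: "\<pi> permutes {..<length vs}"
  shows "cross_polytope_chain n v x (permute_list \<pi> vs) =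
    of_int (sign \<pi>) * (cross_polytope_chain n v x vs :: 'k::field)"
proof (cases "length vs = n")
  case True
  hence p: "\<pi> permutes {0..<n}" using \<pi> by (simp add: atLeast0LessThan)
  have "cross_matrix n v x (permute_list \<pi> vs) =
      (mat n n (\<lambda>(i, j). cross_matrix n v x vs $$ (\<pi> i, j)) :: 'k mat)"
    using permutes_in_image[OF p] True
    by (intro eq_matI) (auto simp: cross_matrix_def permute_list_nth[OF \<pi>])
  thus ?thesis using True det_permute_rows[OF cross_matrix_carrier p, of v x vs]
    by (simp add: cross_polytope_chain_def)
qed (simp add: cross_polytope_chain_def)

lemma sum_cross_polytope_chain:
  assumes "finite S" "v ` {..<n} \<subseteq> S" "x ` {..<n} \<subseteq> S" "n > 0"
  shows "(\<Sum>w\<in>S. cross_polytope_chain n v x (w # vs)) = (0::'k::field)"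
proof (cases "length (undefined # vs) = n")
  case True
  define C :: "nat \<Rightarrow> 'k" where "C j = cofactor (cross_matrix n v x (undefined # vs)) 0 j" for j
  have cof: "cofactor (cross_matrix n v x (w # vs)) 0 j = C j" if "j < n" for w j
  proof -
    have "mat_delete (cross_matrix n v x (w # vs) :: 'k mat) 0 j =
        mat_delete (cross_matrix n v x (undefined # vs)) 0 j"
      using that by (intro eq_matI) (auto simp: mat_delete_def cross_matrix_def)
    thus ?thesis by (simp add: C_def cofactor_def)
  qed
  have "(\<Sum>w\<in>S. cross_polytope_chain n v x (w # vs)) =
      (\<Sum>w\<in>S. \<Sum>j<n. (of_bool (w = v j) - of_bool (w = x j)) * C j)"
    using True assms(4)
    by (intro sum.cong refl)
      (simp add: cross_polytope_chain_def laplace_expansion_row[OF cross_matrix_carrier assms(4)] cof,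
       simp add: cross_matrix_def)
  also have "\<dots> = (\<Sum>j<n. (\<Sum>w\<in>S. of_bool (w = v j) - of_bool (w = x j)) * C j)"
    by (subst sum.swap) (simp add: sum_distrib_right)
  also have "\<dots> = 0"
    using assms by (intro sum.neutral) (auto simp: sum_subtractf of_bool_def)
  finally show ?thesis .
qed (simp add: cross_polytope_chain_def)

definition clique_complex :: "'v set \<Rightarrow> ('v \<Rightarrow> 'v \<Rightarrow> bool) \<Rightarrow> 'v set set" where
  "clique_complex S adj = {\<sigma>. \<sigma> \<subseteq> S \<and> (\<forall>u\<in>\<sigma>. \<forall>w\<in>\<sigma>. adj u w)}"

lemma finite_complex_clique_complex: "finite S \<Longrightarrow> finite_complex S (clique_complex S adj)"
  by unfold_locales (auto simp: clique_complex_def)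

definition cross_polytope :: "('v \<Rightarrow> 'v \<Rightarrow> bool) \<Rightarrow> 't set \<Rightarrow> ('t \<Rightarrow> 'v) \<Rightarrow> ('t \<Rightarrow> 'v) \<Rightarrow> bool" where
  "cross_polytope adj T v x \<longleftrightarrow> (\<forall>s\<in>T. \<not> adj (v s) (x s)) \<and>
     (\<forall>s\<in>T. \<forall>t\<in>T. s \<noteq> t \<longrightarrow> adj (v s) (v t) \<and> adj (v s) (x t) \<and> adj (x s) (x t))"

lemma cross_polytopeD:
  assumes "cross_polytope adj T v x" "s \<in> T"
  shows "\<not> adj (v s) (x s)" "t \<in> T \<Longrightarrow> s \<noteq> t \<Longrightarrow> adj (v s) (v t)"
    "t \<in> T \<Longrightarrow> s \<noteq> t \<Longrightarrow> adj (v s) (x t)" "t \<in> T \<Longrightarrow> s \<noteq> t \<Longrightarrow> adj (x s) (x t)"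
  using assms unfolding cross_polytope_def by blast+

lemma cross_polytope_adj:
  assumes cp: "cross_polytope adj T v x" and "symp adj" and st: "s \<in> T" "t \<in> T" "s \<noteq> t"
    and "a \<in> {v s, x s}" "b \<in> {v t, x t}"
  shows "adj a b"
  using cross_polytopeD(2-4)[OF cp st] assms(6,7)
    sympD[OF \<open>symp adj\<close> cross_polytopeD(3)[OF cp st(2,1) st(3)[symmetric]]] by auto

lemma cross_polytope_reindex:
  assumes "cross_polytope adj T v x" "bij_betw e A T"
  shows "cross_polytope adj A (v \<circ> e) (x \<circ> e)"
proof -
  have mem: "e s \<in> T" if "s \<in> A" for s using bij_betwE[OF assms(2)] that by blast
  have inj: "e s \<noteq> e t" if "s \<in> A" "t \<in> A" "s \<noteq> t" for s t
    using inj_onD[OF bij_betw_imp_inj_on[OF assms(2)]] that by blast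
  show ?thesis
    unfolding cross_polytope_def o_apply
    by (intro conjI ballI impI cross_polytopeD[OF assms(1)] mem inj)
qed

lemma cross_polytope_disjoint:
  assumes cp: "cross_polytope adj T v x" and "reflp adj"
  shows "v ` T \<inter> x ` T = {}"
proof -
  have "v s \<noteq> x t" if "s \<in> T" "t \<in> T" for s t
    using cross_polytopeD(1,2)[OF cp that(2)] that reflpD[OF assms(2)] by metis
  thus ?thesis by blast
qed

lemma cross_polytope_chain_facet:
  assumes cp: "cross_polytope adj {..<n} v x" and "reflp adj"
  shows "cross_polytope_chain n v x (map v [0..<n]) = (1::'k::field)"
proof -
  have "v s = v t \<longleftrightarrow> s = t" if "s < n" "t < n" for s t
    using cross_polytopeD(1)[OF cp, of s] cross_polytopeD(3)[OF cp, of t s] that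
    by (metis lessThan_iff)
  moreover have "v s \<noteq> x t" if "s < n" "t < n" for s t
    using cross_polytope_disjoint[OF assms] that by blast
  ultimately have "cross_matrix n v x (map v [0..<n]) = (1\<^sub>m n :: 'k mat)"
    by (intro eq_matI) (auto simp: cross_matrix_def)
  thus ?thesis by (simp add: cross_polytope_chain_def)
qed

lemma cross_polytope_chain_nonzero_facet:
  assumes nz: "cross_polytope_chain n v x (map w [0..<n]) \<noteq> (0::'k::field)"
    and disjoint: "w ` {..<n} \<inter> x ` {..<n} = {}"
  shows "w ` {..<n} = v ` {..<n}"
proof -
  from cross_polytope_chain_support[OF nz] obtain \<pi> where \<pi>: "\<pi> permutes {..<n}"
    and facet: "\<And>r. r < n \<Longrightarrow> map w [0..<n] ! r \<in> {v (\<pi> r), x (\<pi> r)}" by blast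
  have "w r = v (\<pi> r)" if "r < n" for r
    using facet[OF that] disjoint permutes_in_image[OF \<pi>, of r] that by auto
  hence "w ` {..<n} = v ` \<pi> ` {..<n}" by (auto simp: image_image)
  thus ?thesis by (simp only: permutes_image[OF \<pi>])
qed

lemma cross_polytope_chain_cycle:
  assumes S: "finite S" and "symp adj" "reflp adj"
    and cp: "cross_polytope adj {..<Suc p} v x"
    and vS: "v ` {..<Suc p} \<subseteq> S" and xS: "x ` {..<Suc p} \<subseteq> S"
  shows "(cross_polytope_chain (Suc p) v x :: 'v list \<Rightarrow> 'k::field)
    \<in> simplicial_cycles p (clique_complex S adj)"
proof -
  let ?K = "clique_complex S adj" and ?c = "cross_polytope_chain (Suc p) v x :: 'v list \<Rightarrow> 'k"
  interpret finite_complex S ?K by (rule finite_complex_clique_complex[OF S])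
  have "?c \<in> oriented_chains ?K (Suc p)"
  proof (rule oriented_chainsI)
    fix vs assume nz: "?c vs \<noteq> 0"
    from cross_polytope_chain_support[OF this] obtain \<pi> where
      \<pi>: "\<pi> permutes {..<Suc p}" and len: "length vs = Suc p"
      and vs: "\<And>r. r < Suc p \<Longrightarrow> vs ! r \<in> {v (\<pi> r), x (\<pi> r)}" by blast
    have \<pi>_less: "\<pi> r \<in> {..<Suc p}" if "r < Suc p" for r
      using permutes_in_image[OF \<pi>] that by simp
    have "vs ! r \<in> S" if "r < Suc p" for r
      using vs[OF that] \<pi>_less[OF that] vS xS by blast
    moreover have "adj (vs ! q) (vs ! r)" if "q < Suc p" "r < Suc p" for q r
    proof (cases "q = r")
      case False
      hence "\<pi> q \<noteq> \<pi> r" using permutes_inj[OF \<pi>] by (auto simp: inj_def)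
      thus ?thesis
        using cross_polytope_adj[OF cp \<open>symp adj\<close> \<pi>_less \<pi>_less] vs that by blast
    qed (simp add: reflpD[OF \<open>reflp adj\<close>])
    ultimately have "set vs \<in> ?K"
      using len by (auto simp: clique_complex_def in_set_conv_nth)
    thus "distinct vs \<and> length vs = Suc p \<and> set vs \<in> ?K"
      using len cross_polytope_chain_distinct[OF nz] by blast
  qed (rule cross_polytope_chain_permute)
  moreover from this have "chain_boundary ?c = (\<lambda>_. 0)"
    by (auto simp: chain_boundary_eq_sum sum_cross_polytope_chain[OF S vS xS])
  ultimately show ?thesis by (simp add: simplicial_cycles_def)
qed

lemma card_cross_polytopes_le_reduced_betti:
  fixes v :: "'i \<Rightarrow> 't \<Rightarrow> 'v" and x :: "'t \<Rightarrow> 'v"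
  assumes S: "finite S" and adj: "symp adj" "reflp adj"
    and I: "finite I" and T: "finite T" "card T = Suc p"
    and cp: "\<And>i. i \<in> I \<Longrightarrow> cross_polytope adj T (v i) x"
    and vS: "\<And>i. i \<in> I \<Longrightarrow> v i ` T \<subseteq> S" and xS: "x ` T \<subseteq> S"
    and maximal: "\<And>i w. i \<in> I \<Longrightarrow> w \<in> S \<Longrightarrow> \<forall>s\<in>T. adj w (v i s) \<Longrightarrow> w \<in> v i ` T"
    and inj: "inj_on (\<lambda>i. v i ` T) I"
  shows "card I \<le> reduced_betti TYPE('k::field) p (clique_complex S adj)"
proof -
  let ?K = "clique_complex S adj"
  interpret finite_complex S ?K by (rule finite_complex_clique_complex[OF S])
  obtain e where e: "bij_betw e {..<Suc p} T"
    using ex_bij_betw_nat_finite[OF T(1)] T(2) by (auto simp: atLeast0LessThan)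
  hence eT: "e ` {..<Suc p} = T" by (rule bij_betw_imp_surj_on)
  have image: "(u \<circ> e) ` {..<Suc p} = u ` T" for u :: "'t \<Rightarrow> 'v"
    by (simp only: image_comp[symmetric] eT)
  define z :: "'i \<Rightarrow> 'v list \<Rightarrow> 'k" where "z i = cross_polytope_chain (Suc p) (v i \<circ> e) (x \<circ> e)" for i
  define y where "y i = map (v i \<circ> e) [0..<Suc p]" for i
  have y_set: "set (y i) = v i ` T" for i
    unfolding y_def set_map set_upt atLeast0LessThan image ..
  show ?thesis
  proof (rule card_le_reduced_betti[OF I, where z = z and y = y])
    fix i assume i: "i \<in> I"
    note cp_e = cross_polytope_reindex[OF cp[OF i] e]
    show "z i \<in> simplicial_cycles p ?K"
      unfolding z_def
      by (rule cross_polytope_chain_cycle[OF S adj cp_e]) (simp_all only: image vS[OF i] xS)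
    show "w \<in> set (y i)" if "insert w (set (y i)) \<in> ?K" for w
      using that maximal[OF i, of w] by (auto simp: clique_complex_def y_set)
    fix j assume j: "j \<in> I"
    show "z i (y j) = (if i = j then 1 else 0)"
    proof (cases "i = j")
      case True
      thus ?thesis
        using cross_polytope_chain_facet[OF cp_e adj(2)] by (simp add: z_def y_def)
    next
      case False
      hence "v j ` T \<noteq> v i ` T" using inj i j by (auto dest: inj_onD)
      hence "z i (y j) = 0"
        using cross_polytope_chain_nonzero_facet[of "Suc p" "v i \<circ> e" "x \<circ> e" "v j \<circ> e", where ?'k = 'k]
          cross_polytope_disjoint[OF cp[OF j] adj(2)]
        unfolding image z_def y_def by blast
      thus ?thesis using False by simp
    qed
  qed
qed

section \<open>Graphs of assignments\<close>

text \<open>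
  \<open>v f s\<close> is the vertex of type \<open>s\<close> that remembers the assignment \<open>f\<close> only on \<open>M s\<close>;
  \<open>x s\<close> is antipodal to all vertices of type \<open>s\<close>.
\<close>

locale assignment_graph =
  fixes T :: "'t set" and R :: "'r set" and A :: "'a set" and M :: "'t \<Rightarrow> 'r set"
    and v :: "('r \<Rightarrow> 'a) \<Rightarrow> 't \<Rightarrow> 'v" and x :: "'t \<Rightarrow> 'v" and adj :: "'v \<Rightarrow> 'v \<Rightarrow> bool"
  assumes symp_adj: "symp adj" and reflp_adj: "reflp adj"
    and finite_T: "finite T" and finite_R: "finite R" and finite_A: "finite A"
    and places: "\<And>s. s \<in> T \<Longrightarrow> M s \<subseteq> R"
    and remembered_twice: "\<And>r. r \<in> R \<Longrightarrow> \<exists>s\<in>T. \<exists>t\<in>T. s \<noteq> t \<and> r \<in> M s \<inter> M t"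
    and vertex_cong: "\<And>f g s. (\<And>r. r \<in> M s \<Longrightarrow> f r = g r) \<Longrightarrow> v f s = v g s"
    and adj_iff_agree: "\<And>f g s t. f \<in> R \<rightarrow>\<^sub>E A \<Longrightarrow> g \<in> R \<rightarrow>\<^sub>E A \<Longrightarrow> s \<in> T \<Longrightarrow> t \<in> T \<Longrightarrow> s \<noteq> t \<Longrightarrow>
          adj (v f s) (v g t) \<longleftrightarrow> (\<forall>r \<in> M s \<inter> M t. f r = g r)"
    and adj_antipode_iff: "\<And>f s t. f \<in> R \<rightarrow>\<^sub>E A \<Longrightarrow> s \<in> T \<Longrightarrow> t \<in> T \<Longrightarrow> adj (v f s) (x t) \<longleftrightarrow> s \<noteq> t"
    and adj_antipodes: "\<And>s t. s \<in> T \<Longrightarrow> t \<in> T \<Longrightarrow> s \<noteq> t \<Longrightarrow> adj (x s) (x t)"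
begin

definition vertices :: "'v set" where
  "vertices = (\<Union>s\<in>T. (\<lambda>f. v f s) ` (R \<rightarrow>\<^sub>E A)) \<union> x ` T"

lemma finite_assignments: "finite (R \<rightarrow>\<^sub>E A)"
  by (intro finite_PiE finite_R finite_A)

lemma finite_vertices: "finite vertices"
  unfolding vertices_def using finite_T finite_assignments by simp

lemma card_vertices_le: "card vertices \<le> (\<Sum>s\<in>T. card A ^ card (M s) + 1)"
proof -
  have "card ((\<lambda>f. v f s) ` (R \<rightarrow>\<^sub>E A)) \<le> card A ^ card (M s)" if s: "s \<in> T" for s
  proof -
    have finM: "finite (M s)" using places[OF s] finite_R by (rule finite_subset)
    have "(\<lambda>f. v f s) ` (R \<rightarrow>\<^sub>E A) \<subseteq> (\<lambda>f. v f s) ` (M s \<rightarrow>\<^sub>E A)"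
    proof
      fix w assume "w \<in> (\<lambda>f. v f s) ` (R \<rightarrow>\<^sub>E A)"
      then obtain f where f: "f \<in> R \<rightarrow>\<^sub>E A" "w = v f s" by blast
      have "v f s = v (restrict f (M s)) s" by (intro vertex_cong) simp
      moreover have "restrict f (M s) \<in> M s \<rightarrow>\<^sub>E A" using f(1) places[OF s] by auto
      ultimately show "w \<in> (\<lambda>f. v f s) ` (M s \<rightarrow>\<^sub>E A)" using f(2) by blast
    qed
    hence "card ((\<lambda>f. v f s) ` (R \<rightarrow>\<^sub>E A)) \<le> card (M s \<rightarrow>\<^sub>E A)"
      using finite_A finM by (intro surj_card_le finite_PiE) auto
    thus ?thesis using finM by (simp add: card_PiE)
  qed
  moreover have "card (\<Union>s\<in>T. (\<lambda>f. v f s) ` (R \<rightarrow>\<^sub>E A)) \<le> (\<Sum>s\<in>T. card ((\<lambda>f. v f s) ` (R \<rightarrow>\<^sub>E A)))"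
    by (rule card_UN_le[OF finite_T])
  ultimately have "card (\<Union>s\<in>T. (\<lambda>f. v f s) ` (R \<rightarrow>\<^sub>E A)) \<le> (\<Sum>s\<in>T. card A ^ card (M s))"
    by (meson order_trans sum_mono)
  moreover have "card (x ` T) \<le> card T" by (rule card_image_le[OF finite_T])
  ultimately show ?thesis
    unfolding vertices_def sum.distrib by (intro order_trans[OF card_Un_le] add_mono) auto
qed

lemma cross_polytope_assignment:
  assumes "f \<in> R \<rightarrow>\<^sub>E A"
  shows "cross_polytope adj T (v f) x"
  using adj_iff_agree[OF assms assms] adj_antipode_iff[OF assms] adj_antipodes
  unfolding cross_polytope_def by simp

lemma assignment_facet_maximal:
  assumes f: "f \<in> R \<rightarrow>\<^sub>E A" and w: "w \<in> vertices" "\<forall>s\<in>T. adj w (v f s)"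
  shows "w \<in> v f ` T"
proof -
  from w(1) consider (antipode) s where "s \<in> T" "w = x s"
    | (vertex) g s where "g \<in> R \<rightarrow>\<^sub>E A" "s \<in> T" "w = v g s"
    unfolding vertices_def by blast
  thus ?thesis
  proof cases
    case (antipode s)
    thus ?thesis using adj_antipode_iff[OF f, of s s] w(2) sympD[OF symp_adj] by blast
  next
    case (vertex g s)
    have "g r = f r" if r: "r \<in> M s" for r
    proof -
      obtain t where "t \<in> T" "t \<noteq> s" "r \<in> M t"
        using remembered_twice[of r] places[OF vertex(2)] r by blast
      thus ?thesis using adj_iff_agree[OF vertex(1) f vertex(2), of t] w(2) vertex(3) r by blast
    qed
    hence "w = v f s" unfolding vertex(3) by (intro vertex_cong)
    thus ?thesis using vertex(2) by blast
  qed
qed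

lemma inj_on_assignment_facet: "inj_on (\<lambda>f. v f ` T) (R \<rightarrow>\<^sub>E A)"
proof (rule inj_onI)
  fix f g assume f: "f \<in> R \<rightarrow>\<^sub>E A" and g: "g \<in> R \<rightarrow>\<^sub>E A" and eq: "v f ` T = v g ` T"
  show "f = g"
  proof (rule PiE_ext[OF f g])
    fix r assume "r \<in> R"
    then obtain s t where st: "s \<in> T" "t \<in> T" "s \<noteq> t" "r \<in> M s \<inter> M t"
      using remembered_twice by blast
    obtain u where u: "u \<in> T" "v g t = v f u" using eq st(2) by blast
    have "adj (v f s) (v f u)"
      using adj_iff_agree[OF f f st(1) u(1)] reflpD[OF reflp_adj] by (cases "s = u") auto
    thus "f r = g r" using adj_iff_agree[OF f g st(1-3)] u(2) st(4) by simp
  qed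
qed

lemma card_assignments_le_reduced_betti:
  assumes "card T = Suc p"
  shows "card A ^ card R \<le> reduced_betti TYPE('k::field) p (clique_complex vertices adj)"
proof -
  have "card (R \<rightarrow>\<^sub>E A) \<le> reduced_betti TYPE('k) p (clique_complex vertices adj)"
  proof (rule card_cross_polytopes_le_reduced_betti[OF finite_vertices symp_adj reflp_adj
        finite_assignments finite_T assms cross_polytope_assignment _ _ assignment_facet_maximal
        inj_on_assignment_facet])
    show "v f ` T \<subseteq> vertices" if "f \<in> R \<rightarrow>\<^sub>E A" for f
      using that by (auto simp: vertices_def)
    show "x ` T \<subseteq> vertices" by (simp add: vertices_def)
  qed
  thus ?thesis by (simp add: card_PiE[OF finite_R])
qed

end

section \<open>The point configuration\<close>

datatype corner = Left | Right | Top

primrec next_corner :: "corner \<Rightarrow> corner" where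
  "next_corner Left = Right" | "next_corner Right = Top" | "next_corner Top = Left"

abbreviation prev_corner :: "corner \<Rightarrow> corner" where
  "prev_corner a \<equiv> next_corner (next_corner a)"

lemma next_corner_cycle:
  "next_corner a \<noteq> a" "prev_corner a \<noteq> a" "prev_corner a \<noteq> next_corner a"
  "next_corner (prev_corner a) = a"
  by (cases a; simp)+

lemma distinct_corners_next: "a \<noteq> b \<Longrightarrow> b = next_corner a \<or> a = next_corner b"
  by (cases a; cases b) simp_all

primrec corner_point :: "corner \<Rightarrow> complex" where
  "corner_point Left = Complex (- 1 / 2) (- sqrt (1 / 12))"
| "corner_point Right = Complex (1 / 2) (- sqrt (1 / 12))"
| "corner_point Top = Complex 0 (2 * sqrt (1 / 12))"

lemma inner_corner_point:
  "inner (corner_point a) (corner_point b) = (if a = b then 1 / 3 else - 1 / 6)"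
  by (cases a; cases b; simp add: inner_complex_def power2_eq_square)

primrec corner_axis :: "corner \<Rightarrow> complex \<times> real" where
  "corner_axis Left = (1, 0)" | "corner_axis Right = (\<i>, 0)" | "corner_axis Top = (0, 1)"

lemma inner_corner_axis: "inner (corner_axis a) (corner_axis b) = of_bool (a = b)"
  by (cases a; cases b) (simp_all add: inner_complex_def)

datatype vertex_type = Corner corner | End nat bool

text \<open>The angles \<open>1 / (k + 1)\<close> only have to make the diameters pairwise non-parallel.\<close>

primrec base :: "vertex_type \<Rightarrow> complex \<times> complex \<times> real" where
  "base (Corner a) = (corner_point a, 0, 0)"
| "base (End k b) = (0, (if b then 1 / 2 else - 1 / 2) *\<^sub>R cis (1 / real (Suc k)), 0)"

lemma inner_base_corners:
  "inner (base (Corner a)) (base (Corner b)) = (if a = b then 1 / 3 else - 1 / 6)"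
  by (simp add: inner_corner_point)

lemma inner_base_corner_end:
  "inner (base (Corner a)) (base (End k b)) = 0" "inner (base (End k b)) (base (Corner a)) = 0"
  by simp_all

lemma inner_base_ends:
  "inner (base (End k b)) (base (End l c)) =
     (if b = c then 1 / 4 else - 1 / 4) * cos (1 / real (Suc k) - 1 / real (Suc l))"
  by (auto simp: inner_complex_def cos_diff algebra_simps)

lemmas inner_base = inner_base_corners inner_base_corner_end inner_base_ends

lemma cos_reciprocal_diff:
  assumes "k \<noteq> l"
  shows "0 < cos (1 / real (Suc k) - 1 / real (Suc l))"
    and "cos (1 / real (Suc k) - 1 / real (Suc l)) < 1"
proof -
  let ?x = "1 / real (Suc k) - 1 / real (Suc l)"
  have "0 < 1 / real (Suc k)" "1 / real (Suc k) \<le> 1" "0 < 1 / real (Suc l)" "1 / real (Suc l) \<le> 1"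
    by simp_all
  hence bound: "- 1 < ?x" "?x < 1" by linarith+
  have "?x \<noteq> 0" using assms by simp
  hence "0 < \<bar>?x\<bar>" "\<bar>?x\<bar> \<le> pi" using bound pi_gt3 by linarith+
  from cos_monotone_0_pi[OF order_refl this] show "cos ?x < 1"
    by (simp only: cos_abs_real cos_zero)
  show "0 < cos ?x" using bound pi_gt3 by (intro cos_gt_zero_pi) auto
qed

declare base.simps [simp del]

lemma inner_add_self: "inner (x + y) (x + y) = inner x x + inner y y + 2 * inner x y"
  by (simp add: inner_add_left inner_add_right inner_commute)

lemma inner_diff_self: "inner (x - y) (x - y) = inner x x + inner y y - 2 * inner x y"
  by (simp add: inner_diff_left inner_diff_right inner_commute)

primrec memory :: "vertex_type \<Rightarrow> vertex_type set" where
  "memory (Corner a) = {Corner a, Corner (next_corner a)}"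
| "memory (End k b) = {End k True, End k False}"

lemma card_memory: "card (memory s) = 2"
  by (cases s) (simp_all add: next_corner_cycle(1)[symmetric])

lemma memory_Int_next_corner:
  "memory (Corner a) \<inter> memory (Corner (next_corner a)) = {Corner (next_corner a)}"
  by (cases a) auto

lemma dist_base_bounds:
  assumes "s \<noteq> t"
  shows "dist (base s) (base t) \<le> 1" "dist (base s) (- base t) < 1"
    and "memory s \<inter> memory t = {} \<Longrightarrow> dist (base s) (base t) < 1"
proof -
  note dist_simps = dist_norm norm_le_square norm_lt_square inner_add_self inner_diff_self inner_base
  consider (corners) a b where "s = Corner a" "t = Corner b"
    | (mixed) a k b where "s = Corner a \<and> t = End k b \<or> s = End k b \<and> t = Corner a"
    | (ends) k b l c where "s = End k b" "t = End l c"
    by (cases s; cases t) auto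
  hence "dist (base s) (base t) \<le> 1 \<and> dist (base s) (- base t) < 1 \<and>
    (memory s \<inter> memory t = {} \<longrightarrow> dist (base s) (base t) < 1)"
  proof cases
    case corners
    thus ?thesis
      using assms distinct_corners_next[of a b] by (auto simp: dist_simps)
  next
    case mixed
    thus ?thesis by (auto simp: dist_simps)
  next
    case ends
    thus ?thesis
      using assms cos_reciprocal_diff[of k l] by (cases "k = l") (auto simp: dist_simps)
  qed
  thus "dist (base s) (base t) \<le> 1" "dist (base s) (- base t) < 1"
    and "memory s \<inter> memory t = {} \<Longrightarrow> dist (base s) (base t) < 1" by blast+
qed

text \<open>
  With \<open>P\<close>, \<open>Q\<close>, \<open>R\<close> the corners \<open>a\<close>, \<open>next_corner a\<close>, \<open>prev_corner a\<close>, the shift \<open>\<delta>\<close> solves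
  \<open>2 (P - Q) \<bullet> \<delta> = -(i\<^sup>2 + 1/4)\<close> and \<open>2 (P - R) \<bullet> \<delta> = -(j\<^sup>2 + 1/4)\<close>. In \<open>vertex\<close> it cancels,
  up to \<open>O(\<epsilon>\<^sup>4)\<close>, what the values that two corners do not share contribute to their squared distance.
\<close>

definition corner_shift :: "corner \<Rightarrow> real \<Rightarrow> real \<Rightarrow> complex" where
  "corner_shift a i j =
     ((i\<^sup>2 - j\<^sup>2) / 2) *\<^sub>R (corner_point (next_corner a) - corner_point (prev_corner a))
       - ((i\<^sup>2 + j\<^sup>2 + 1 / 2) / 2) *\<^sub>R corner_point a"

text \<open>The summand 1 keeps both ends of a diameter at distance more than 1 from their antipodes.\<close>

definition end_code :: "(vertex_type \<Rightarrow> nat) \<Rightarrow> nat \<Rightarrow> real" where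
  "end_code f k = 1 + real (prod_encode (f (End k True), f (End k False)))"

lemma end_code_pos: "end_code f k > 0"
  by (simp add: end_code_def)

lemma end_code_eq_iff:
  "end_code f k = end_code g k \<longleftrightarrow> f (End k True) = g (End k True) \<and> f (End k False) = g (End k False)"
  by (simp add: end_code_def prod_encode_eq)

primrec vertex :: "real \<Rightarrow> (vertex_type \<Rightarrow> nat) \<Rightarrow> vertex_type \<Rightarrow> complex \<times> complex \<times> real" where
  "vertex \<epsilon> f (Corner a) =
     (corner_point a + \<epsilon>\<^sup>2 *\<^sub>R corner_shift a (f (Corner a)) (f (Corner (next_corner a))),
      \<epsilon> *\<^sub>R (f (Corner a) *\<^sub>R corner_axis a
        + f (Corner (next_corner a)) *\<^sub>R corner_axis (next_corner a)))"
| "vertex \<epsilon> f (End k b) =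
     base (End k b) + (0, 0, \<epsilon> * end_code f k)"

declare vertex.simps [simp del]

lemma vertex_cong: "(\<And>r. r \<in> memory s \<Longrightarrow> f r = g r) \<Longrightarrow> vertex \<epsilon> f s = vertex \<epsilon> g s"
  by (cases s) (auto simp: vertex.simps end_code_def)

lemma vertex_tendsto: "((\<lambda>\<epsilon>. vertex \<epsilon> f s) \<longlongrightarrow> base s) (at_right 0)"
  by (cases s) (auto simp: vertex.simps base.simps simp flip: zero_prod_def intro!: tendsto_eq_intros)

lemma eventually_dist_vertex_le_1:
  assumes "dist (base s) (base t) < 1"
  shows "\<forall>\<^sub>F \<epsilon> in at_right 0. dist (vertex \<epsilon> f s) (vertex \<epsilon> g t) \<le> 1"
  using order_tendstoD(2)[OF tendsto_dist[OF vertex_tendsto[of f s] vertex_tendsto[of g t]] assms]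
  by (rule eventually_mono) simp

lemma inner_corner_shift:
  "inner (corner_point a - corner_point (next_corner a)) (corner_shift a i j) = - (i\<^sup>2 + 1 / 4) / 2"
  "inner (corner_point a - corner_point (next_corner a)) (corner_shift (next_corner a) i j) =
     (j\<^sup>2 + 1 / 4) / 2"
  using next_corner_cycle[of a]
  by (auto simp: corner_shift_def inner_diff_left inner_diff_right inner_corner_point)
    (simp_all add: field_simps)

lemma inner_corner_axes:
  assumes "a \<noteq> b" "b \<noteq> c" "a \<noteq> c"
  shows "inner (p *\<^sub>R corner_axis a + q *\<^sub>R corner_axis b + r *\<^sub>R corner_axis c)
      (p *\<^sub>R corner_axis a + q *\<^sub>R corner_axis b + r *\<^sub>R corner_axis c) = p\<^sup>2 + q\<^sup>2 + r\<^sup>2"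
  using assms by (simp add: inner_add_left inner_add_right inner_corner_axis power2_eq_square)

lemma dist_vertex_corners:
  obtains c where "\<And>\<epsilon>. (dist (vertex \<epsilon> f (Corner a)) (vertex \<epsilon> g (Corner (next_corner a))))\<^sup>2 =
    1 + \<epsilon>\<^sup>2 * ((real (f (Corner (next_corner a))) - real (g (Corner (next_corner a))))\<^sup>2 - 1 / 2
      + \<epsilon>\<^sup>2 * c)"
proof
  define i j where "i = real (f (Corner a))" and "j = real (f (Corner (next_corner a)))"
  define i' j' where "i' = real (g (Corner (next_corner a)))"
    and "j' = real (g (Corner (prev_corner a)))"
  let ?P = "corner_point a - corner_point (next_corner a)"
  let ?D = "corner_shift a i j - corner_shift (next_corner a) i' j'"
  let ?w = "i *\<^sub>R corner_axis a + (j - i') *\<^sub>R corner_axis (next_corner a)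
    + (- j') *\<^sub>R corner_axis (prev_corner a)"
  fix \<epsilon> :: real
  have "vertex \<epsilon> f (Corner a) - vertex \<epsilon> g (Corner (next_corner a)) = (?P + \<epsilon>\<^sup>2 *\<^sub>R ?D, \<epsilon> *\<^sub>R ?w)"
    unfolding i_def j_def i'_def j'_def vertex.simps diff_Pair
    by (simp add: scaleR_diff_right scaleR_diff_left scaleR_add_right)
  hence "(dist (vertex \<epsilon> f (Corner a)) (vertex \<epsilon> g (Corner (next_corner a))))\<^sup>2 =
      inner (?P + \<epsilon>\<^sup>2 *\<^sub>R ?D) (?P + \<epsilon>\<^sup>2 *\<^sub>R ?D) + inner (\<epsilon> *\<^sub>R ?w) (\<epsilon> *\<^sub>R ?w)"
    by (simp only: dist_norm power2_norm_eq_inner inner_Pair)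
  also have "inner (\<epsilon> *\<^sub>R ?w) (\<epsilon> *\<^sub>R ?w) = \<epsilon>\<^sup>2 * (i\<^sup>2 + (j - i')\<^sup>2 + j'\<^sup>2)"
    by (simp only: inner_scaleR_left inner_scaleR_right inner_corner_axes
        next_corner_cycle(1-3)[symmetric] not_False_eq_True) (simp add: power2_eq_square)
  also have "inner (?P + \<epsilon>\<^sup>2 *\<^sub>R ?D) (?P + \<epsilon>\<^sup>2 *\<^sub>R ?D) =
      inner ?P ?P + 2 * \<epsilon>\<^sup>2 * inner ?P ?D + \<epsilon>\<^sup>2 * \<epsilon>\<^sup>2 * inner ?D ?D"
    by (simp add: inner_add_self power2_eq_square)
  also have "inner ?P ?P = 1"
    using next_corner_cycle[of a] by (simp add: inner_diff_self inner_corner_point)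
  also have "inner ?P ?D = - (i\<^sup>2 + j'\<^sup>2 + 1 / 2) / 2"
    unfolding inner_diff_right[of ?P] inner_corner_shift by (simp add: field_simps)
  finally show "(dist (vertex \<epsilon> f (Corner a)) (vertex \<epsilon> g (Corner (next_corner a))))\<^sup>2 =
    1 + \<epsilon>\<^sup>2 * ((real (f (Corner (next_corner a))) - real (g (Corner (next_corner a))))\<^sup>2 - 1 / 2
      + \<epsilon>\<^sup>2 * inner ?D ?D)"
    unfolding j_def[symmetric] i'_def[symmetric] by (simp add: field_simps)
qed

lemma dist_vertex_ends:
  "(dist (vertex \<epsilon> f (End k b)) (vertex \<epsilon> g (End k (\<not> b))))\<^sup>2 =
     1 + \<epsilon>\<^sup>2 * (end_code f k - end_code g k)\<^sup>2"
  by (cases b)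
    (simp_all add: vertex.simps base.simps dist_norm norm_Pair power_mult_distrib
      flip: scaleR_diff_left right_diff_distrib)

lemma dist_vertex_end_antipode:
  "(dist (vertex \<epsilon> f (End k b)) (- base (End k b)))\<^sup>2 =
     1 + \<epsilon>\<^sup>2 * (end_code f k)\<^sup>2"
  by (cases b)
    (simp_all add: vertex.simps base.simps dist_norm norm_Pair power_mult_distrib
      flip: scaleR_add_left)

lemma eventually_dist_corners_le_1_iff:
  "\<forall>\<^sub>F \<epsilon> in at_right 0. dist (vertex \<epsilon> f (Corner a)) (vertex \<epsilon> g (Corner (next_corner a))) \<le> 1 \<longleftrightarrow>
     f (Corner (next_corner a)) = g (Corner (next_corner a))"
proof -
  let ?d = "\<lambda>\<epsilon>. dist (vertex \<epsilon> f (Corner a)) (vertex \<epsilon> g (Corner (next_corner a)))"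
  define k where "k = (real (f (Corner (next_corner a))) - real (g (Corner (next_corner a))))\<^sup>2 - 1 / 2"
  obtain c where d: "\<And>\<epsilon>. (?d \<epsilon>)\<^sup>2 = 1 + \<epsilon>\<^sup>2 * (k + \<epsilon>\<^sup>2 * c)"
    using dist_vertex_corners unfolding k_def by metis
  have d_le: "?d \<epsilon> \<le> 1 \<longleftrightarrow> k + \<epsilon>\<^sup>2 * c \<le> 0" if "\<epsilon> > 0" for \<epsilon>
  proof -
    have "?d \<epsilon> \<le> 1 \<longleftrightarrow> (?d \<epsilon>)\<^sup>2 \<le> 1" by (simp add: power_le_one_iff)
    thus ?thesis using that unfolding d by (simp add: mult_le_0_iff)
  qed
  have pos: "\<forall>\<^sub>F \<epsilon>::real in at_right 0. \<epsilon> > 0" by (rule eventually_at_right_less)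
  have lim: "((\<lambda>\<epsilon>. k + \<epsilon>\<^sup>2 * c) \<longlongrightarrow> k) (at_right 0)" by (auto intro!: tendsto_eq_intros)
  show ?thesis
  proof (cases "f (Corner (next_corner a)) = g (Corner (next_corner a))")
    case True
    hence "k < 0" by (simp add: k_def)
    from order_tendstoD(2)[OF lim this] pos show ?thesis
      by eventually_elim (simp add: d_le True)
  next
    case False
    hence "1 \<le> \<bar>real (f (Corner (next_corner a))) - real (g (Corner (next_corner a)))\<bar>" by linarith
    hence "k > 0" using one_le_power[of _ 2] by (force simp: k_def)
    from order_tendstoD(1)[OF lim this] pos show ?thesis
      by eventually_elim (simp add: d_le False)
  qed
qed

lemma dist_vertex_ends_le_1_iff:
  assumes "\<epsilon> > 0" "b \<noteq> c"
  shows "dist (vertex \<epsilon> f (End k b)) (vertex \<epsilon> g (End k c)) \<le> 1 \<longleftrightarrow>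
    (\<forall>r\<in>memory (End k b). f r = g r)"
proof -
  let ?d = "dist (vertex \<epsilon> f (End k b)) (vertex \<epsilon> g (End k c))"
  have c: "c = (\<not> b)" using assms(2) by blast
  have "?d \<le> 1 \<longleftrightarrow> ?d\<^sup>2 \<le> 1" by (simp add: power_le_one_iff)
  thus ?thesis
    using assms(1) unfolding c dist_vertex_ends
    by (simp add: mult_le_0_iff end_code_eq_iff)
qed

lemma eventually_dist_vertices_le_1_iff:
  assumes "s \<noteq> t"
  shows "\<forall>\<^sub>F \<epsilon> in at_right 0.
    dist (vertex \<epsilon> f s) (vertex \<epsilon> g t) \<le> 1 \<longleftrightarrow> (\<forall>r \<in> memory s \<inter> memory t. f r = g r)"
proof -
  consider (subsequent) a where "s = Corner a" "t = Corner (next_corner a)"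
    | (previous) a where "s = Corner (next_corner a)" "t = Corner a"
    | (opposite) k b c where "s = End k b" "t = End k c" "b \<noteq> c"
    | (disjoint) "memory s \<inter> memory t = {}"
    using assms distinct_corners_next by (cases s; cases t) auto
  thus ?thesis
  proof cases
    case subsequent
    show ?thesis
      using eventually_dist_corners_le_1_iff[of f a g]
      by (simp add: subsequent memory_Int_next_corner del: memory.simps)
  next
    case previous
    show ?thesis
      using eventually_dist_corners_le_1_iff[of g a f]
      by (simp add: previous Int_commute[of _ "memory (Corner a)"] memory_Int_next_corner
          dist_commute eq_commute del: memory.simps)
  next
    case opposite
    have "\<forall>\<^sub>F \<epsilon>::real in at_right 0. \<epsilon> > 0" by (rule eventually_at_right_less)
    thus ?thesis
      by (rule eventually_mono)
        (simp add: opposite(1,2) dist_vertex_ends_le_1_iff[OF _ opposite(3)])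
  next
    case disjoint
    show ?thesis
      using eventually_dist_vertex_le_1[OF dist_base_bounds(3)[OF assms disjoint]]
      by (simp add: disjoint)
  qed
qed

lemma eventually_dist_antipode_le_1_iff:
  "\<forall>\<^sub>F \<epsilon> in at_right 0. dist (vertex \<epsilon> f s) (- base t) \<le> 1 \<longleftrightarrow> s \<noteq> t"
proof (cases "s = t")
  case False
  have "\<forall>\<^sub>F \<epsilon> in at_right 0. dist (vertex \<epsilon> f s) (- base t) < 1"
    by (rule order_tendstoD(2)[OF tendsto_dist[OF vertex_tendsto tendsto_const]
        dist_base_bounds(2)[OF False]])
  thus ?thesis by (rule eventually_mono) (simp add: False)
next
  case True
  have "\<forall>\<^sub>F \<epsilon> in at_right 0. 1 < dist (vertex \<epsilon> f s) (- base s)"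
  proof (cases s)
    case (Corner a)
    have "1 < dist (base s) (- base s)"
      unfolding Corner dist_norm norm_gt_square by (simp add: inner_add_self inner_base)
    thus ?thesis by (rule order_tendstoD(1)[OF tendsto_dist[OF vertex_tendsto tendsto_const]])
  next
    case (End k b)
    have "1 < dist (vertex \<epsilon> f s) (- base s)" if "\<epsilon> > 0" for \<epsilon>
    proof -
      have "1 < (dist (vertex \<epsilon> f s) (- base s))\<^sup>2"
        using that end_code_pos[of f k] unfolding End dist_vertex_end_antipode by simp
      thus ?thesis by (rule power2_less_imp_less[of 1, simplified]) simp
    qed
    thus ?thesis using eventually_at_right_less[of "0::real"] by (rule eventually_mono[rotated])
  qed
  thus ?thesis by (rule eventually_mono) (simp add: True)
qed

lemma remembered_by_two_types:
  assumes closed: "\<And>s. s \<in> T \<Longrightarrow> memory s \<subseteq> T" and r: "r \<in> T"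
  shows "\<exists>s\<in>T. \<exists>t\<in>T. s \<noteq> t \<and> r \<in> memory s \<inter> memory t"
proof (cases r)
  case (Corner a)
  have "Corner (next_corner a) \<in> T" "Corner (prev_corner a) \<in> T"
    using closed[of "Corner a"] closed[of "Corner (next_corner a)"] r Corner by auto
  moreover have "r \<in> memory (Corner a) \<inter> memory (Corner (prev_corner a))"
    by (simp add: Corner next_corner_cycle)
  moreover have "Corner a \<noteq> Corner (prev_corner a)" using next_corner_cycle[of a] by simp
  ultimately show ?thesis using r Corner by blast
next
  case (End k b)
  have "memory (End k b) \<subseteq> T" using closed[OF r] End by simp
  hence "End k True \<in> T" "End k False \<in> T" by simp_all
  moreover have "r \<in> memory (End k True) \<inter> memory (End k False)"
    using End by (cases b) simp_all
  ultimately show ?thesis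
    by (intro bexI[of _ "End k True"] bexI[of _ "End k False"]) simp_all
qed

lemma exists_closed_vertex_types:
  assumes "p > 0"
  obtains T where "finite T" "card T = Suc p" "\<And>s. s \<in> T \<Longrightarrow> memory s \<subseteq> T"
proof -
  define ends where "ends q = (\<lambda>(k, b). End k b) ` ({..<q} \<times> UNIV)" for q
  have finite_ends: "finite (ends q)" and card_ends: "card (ends q) = 2 * q" for q
    by (simp_all add: ends_def card_image inj_on_def card_cartesian_product)
  have mem_ends: "End k b \<in> ends q \<longleftrightarrow> k < q" "Corner a \<notin> ends q" for k b a q
    by (auto simp: ends_def image_iff)
  have ends_closed: "memory s \<subseteq> ends q" if "s \<in> ends q" for s q
    using that by (cases s) (simp_all add: mem_ends)
  show ?thesis
  proof (cases "even p")
    case False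
    hence "card (ends (Suc p div 2)) = Suc p" unfolding card_ends by simp
    from that[OF finite_ends this ends_closed] show ?thesis .
  next
    case True
    have corners: "(UNIV :: corner set) = {Left, Right, Top}" using corner.exhaust by blast
    have "card (range Corner \<union> ends (p div 2 - 1)) = card (range Corner) + card (ends (p div 2 - 1))"
      by (rule card_Un_disjoint) (auto simp: corners finite_ends mem_ends)
    also have "card (range Corner) = 3" by (simp add: corners)
    also have "3 + card (ends (p div 2 - 1)) = Suc p"
      using True assms by (auto simp: card_ends elim!: evenE)
    finally have "card (range Corner \<union> ends (p div 2 - 1)) = Suc p" .
    moreover have "finite (range Corner \<union> ends (p div 2 - 1))" by (simp add: corners finite_ends)
    moreover have "memory s \<subseteq> range Corner \<union> ends (p div 2 - 1)"
      if "s \<in> range Corner \<union> ends (p div 2 - 1)" for s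
      using that by (cases s) (auto simp: mem_ends)
    ultimately show ?thesis by (intro that)
  qed
qed

section \<open>Betti numbers of Vietoris-Rips complexes\<close>

lemma vietoris_rips_eq_clique_complex:
  assumes "finite S"
  shows "vietoris_rips d S = clique_complex S (\<lambda>u w. euclidean_dist d u w \<le> 1)"
proof -
  have "euclidean_diameter d \<sigma> \<le> 1 \<longleftrightarrow> (\<forall>u\<in>\<sigma>. \<forall>w\<in>\<sigma>. euclidean_dist d u w \<le> 1)"
    if "\<sigma> \<subseteq> S" for \<sigma>
  proof (cases "\<sigma> = {}")
    case False
    have "finite \<sigma>" using finite_subset[OF that assms] .
    hence "bdd_above ((\<lambda>(x, y). euclidean_dist d x y) ` (\<sigma> \<times> \<sigma>))" by (intro bdd_above_finite) auto
    hence "(SUP (x, y)\<in>\<sigma> \<times> \<sigma>. euclidean_dist d x y) \<le> 1 \<longleftrightarrow>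
        (\<forall>z\<in>\<sigma> \<times> \<sigma>. (case z of (x, y) \<Rightarrow> euclidean_dist d x y) \<le> 1)"
      using False by (intro cSUP_le_iff) auto
    with False show ?thesis by (auto simp: euclidean_diameter_def)
  qed (simp add: euclidean_diameter_def)
  thus ?thesis unfolding vietoris_rips_def clique_complex_def by blast
qed

lemma reduced_betti_vietoris_rips_le:
  assumes "finite S"
  shows "reduced_betti TYPE('k::field) p (vietoris_rips d S) \<le> card S ^ Suc p"
  unfolding vietoris_rips_eq_clique_complex[OF assms]
  by (rule finite_complex.reduced_betti_le[OF finite_complex_clique_complex[OF assms]])

lemma reduced_betti_le_max_rips_betti:
  assumes "S \<subseteq> topspace (Euclidean_space d)" "finite S" "card S \<le> n"
  shows "reduced_betti TYPE('k::field) p (vietoris_rips d S) \<le> max_rips_betti TYPE('k) p d n"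
  unfolding max_rips_betti_def
proof (rule Max_ge)
  let ?M = "{reduced_betti TYPE('k) p (vietoris_rips d S) | S.
    S \<subseteq> topspace (Euclidean_space d) \<and> finite S \<and> card S \<le> n}"
  have "reduced_betti TYPE('k) p (vietoris_rips d S) \<le> n ^ Suc p"
    if "finite S" "card S \<le> n" for S
    using reduced_betti_vietoris_rips_le[OF that(1)] power_mono[OF that(2), of "Suc p"]
    by (meson le0 order_trans)
  hence "?M \<subseteq> {..n ^ Suc p}" by blast
  thus "finite ?M" by (rule finite_subset) simp
  show "reduced_betti TYPE('k) p (vietoris_rips d S) \<in> ?M" using assms by blast
qed

fun coordinates :: "complex \<times> complex \<times> real \<Rightarrow> nat \<Rightarrow> real" where
  "coordinates (z, w, h) c = (if c < 5 then [Re z, Im z, Re w, Im w, h] ! c else 0)"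

lemma coordinates_in_Euclidean_space: "d \<ge> 5 \<Longrightarrow> coordinates x \<in> topspace (Euclidean_space d)"
  by (cases x) (simp add: topspace_Euclidean_space)

lemma euclidean_dist_coordinates:
  assumes "d \<ge> 5"
  shows "euclidean_dist d (coordinates x) (coordinates y) = dist x y"
proof -
  obtain z w h z' w' h' where xy: "x = (z, w, h)" "y = (z', w', h')" by (metis prod_cases3)
  have "(\<Sum>c<d. (coordinates x c - coordinates y c)\<^sup>2) = (\<Sum>c<5. (coordinates x c - coordinates y c)\<^sup>2)"
    using assms unfolding xy by (intro sum.mono_neutral_right) auto
  also have "\<dots> = (Re z - Re z')\<^sup>2 + (Im z - Im z')\<^sup>2
      + ((Re w - Re w')\<^sup>2 + (Im w - Im w')\<^sup>2 + (h - h')\<^sup>2)"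
    by (simp add: xy lessThan_nat_numeral lessThan_Suc)
  finally show ?thesis
    by (simp add: euclidean_dist_def L2_set_def xy dist_norm norm_Pair cmod_power2)
qed

definition realizes_agreement :: "(vertex_type \<Rightarrow> nat) set \<Rightarrow> vertex_type set \<Rightarrow> real \<Rightarrow> bool" where
  "realizes_agreement F T \<epsilon> \<longleftrightarrow>
     (\<forall>f\<in>F. \<forall>s\<in>T. \<forall>t\<in>T. dist (vertex \<epsilon> f s) (- base t) \<le> 1 \<longleftrightarrow> s \<noteq> t) \<and>
     (\<forall>f\<in>F. \<forall>g\<in>F. \<forall>s\<in>T. \<forall>t\<in>T. s \<noteq> t \<longrightarrow>
        (dist (vertex \<epsilon> f s) (vertex \<epsilon> g t) \<le> 1 \<longleftrightarrow> (\<forall>r \<in> memory s \<inter> memory t. f r = g r)))"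

lemma eventually_realizes_agreement:
  assumes "finite F" "finite T"
  shows "eventually (realizes_agreement F T) (at_right 0)"
proof -
  have "\<forall>\<^sub>F \<epsilon> in at_right 0. s \<noteq> t \<longrightarrow>
      (dist (vertex \<epsilon> f s) (vertex \<epsilon> g t) \<le> 1 \<longleftrightarrow> (\<forall>r \<in> memory s \<inter> memory t. f r = g r))" for f g s t
    using eventually_dist_vertices_le_1_iff[of s t f g] by (cases "s = t") simp_all
  thus ?thesis
    unfolding realizes_agreement_def
    by (intro eventually_conj eventually_ball_finite ballI assms eventually_dist_antipode_le_1_iff)
qed

lemma assignment_graph_coordinates:
  assumes d: "d \<ge> 5" and T: "finite T" and closed: "\<And>s. s \<in> T \<Longrightarrow> memory s \<subseteq> T"
    and agreement: "realizes_agreement (T \<rightarrow>\<^sub>E {..<m}) T \<epsilon>"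
  shows "assignment_graph T T {..<m} memory (\<lambda>f s. coordinates (vertex \<epsilon> f s))
    (\<lambda>s. coordinates (- base s)) (\<lambda>u w. euclidean_dist d u w \<le> 1)"
proof
  show "symp (\<lambda>u w. euclidean_dist d u w \<le> 1)"
    by (simp add: symp_def euclidean_dist_def L2_set_def power2_commute)
  show "reflp (\<lambda>u w. euclidean_dist d u w \<le> 1)"
    by (simp add: reflp_def euclidean_dist_def L2_set_def)
  show "\<exists>s\<in>T. \<exists>t\<in>T. s \<noteq> t \<and> r \<in> memory s \<inter> memory t" if "r \<in> T" for r
    by (rule remembered_by_two_types[OF closed that])
  show "coordinates (vertex \<epsilon> f s) = coordinates (vertex \<epsilon> g s)"
    if "\<And>r. r \<in> memory s \<Longrightarrow> f r = g r" for f g s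
    using vertex_cong[OF that] by simp
  show "euclidean_dist d (coordinates (vertex \<epsilon> f s)) (coordinates (vertex \<epsilon> g t)) \<le> 1 \<longleftrightarrow>
      (\<forall>r \<in> memory s \<inter> memory t. f r = g r)"
    if "f \<in> T \<rightarrow>\<^sub>E {..<m}" "g \<in> T \<rightarrow>\<^sub>E {..<m}" "s \<in> T" "t \<in> T" "s \<noteq> t" for f g s t
    using agreement that unfolding euclidean_dist_coordinates[OF d] realizes_agreement_def by blast
  show "euclidean_dist d (coordinates (vertex \<epsilon> f s)) (coordinates (- base t)) \<le> 1 \<longleftrightarrow> s \<noteq> t"
    if "f \<in> T \<rightarrow>\<^sub>E {..<m}" "s \<in> T" "t \<in> T" for f s t
    using agreement that unfolding euclidean_dist_coordinates[OF d] realizes_agreement_def by blast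
qed (simp_all only: T closed finite_lessThan euclidean_dist_coordinates[OF d] dist_minus
    dist_base_bounds(1) not_False_eq_True)

lemma vietoris_rips_with_large_betti:
  assumes p: "p > 0" and d: "d \<ge> 5"
  obtains S where "S \<subseteq> topspace (Euclidean_space d)" "finite S" "card S \<le> Suc p * (m\<^sup>2 + 1)"
    "m ^ Suc p \<le> reduced_betti TYPE('k::field) p (vietoris_rips d S)"
proof -
  obtain T where T: "finite T" "card T = Suc p" and closed: "\<And>s. s \<in> T \<Longrightarrow> memory s \<subseteq> T"
    by (rule exists_closed_vertex_types[OF p]) blast
  have "finite (T \<rightarrow>\<^sub>E {..<m})" using T(1) by (intro finite_PiE) auto
  from eventually_happens'[OF _ eventually_realizes_agreement[OF this T(1)]]
  obtain \<epsilon> where \<epsilon>: "realizes_agreement (T \<rightarrow>\<^sub>E {..<m}) T \<epsilon>" by auto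
  interpret assignment_graph T T "{..<m}" memory "\<lambda>f s. coordinates (vertex \<epsilon> f s)"
    "\<lambda>s. coordinates (- base s)" "\<lambda>u w. euclidean_dist d u w \<le> 1"
    by (rule assignment_graph_coordinates[OF d T(1) closed \<epsilon>])
  show ?thesis
  proof
    show "vertices \<subseteq> topspace (Euclidean_space d)"
      unfolding vertices_def by (auto intro: coordinates_in_Euclidean_space[OF d])
    show "finite vertices" by (rule finite_vertices)
    show "card vertices \<le> Suc p * (m\<^sup>2 + 1)" using card_vertices_le by (simp add: card_memory T(2))
    show "m ^ Suc p \<le> reduced_betti TYPE('k) p (vietoris_rips d vertices)"
      using card_assignments_le_reduced_betti[OF T(2), where ?'k = 'k]
      by (simp add: T(2) vietoris_rips_eq_clique_complex[OF finite_vertices])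
  qed
qed

lemma power_le_max_rips_betti:
  assumes "p > 0" "d \<ge> 5" and n: "Suc p * (m\<^sup>2 + 1) \<le> n"
  shows "m ^ Suc p \<le> max_rips_betti TYPE('k::field) p d n"
proof -
  obtain S where S: "S \<subseteq> topspace (Euclidean_space d)" "finite S" "card S \<le> Suc p * (m\<^sup>2 + 1)"
    and betti: "m ^ Suc p \<le> reduced_betti TYPE('k) p (vietoris_rips d S)"
    using vietoris_rips_with_large_betti[OF assms(1,2)] .
  note betti
  also have "reduced_betti TYPE('k) p (vietoris_rips d S) \<le> max_rips_betti TYPE('k) p d n"
    using S(1,2) order_trans[OF S(3) n] by (rule reduced_betti_le_max_rips_betti)
  finally show ?thesis .
qed

lemma eventually_powr_le_of_square_samples:
  fixes g :: "nat \<Rightarrow> nat"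
  assumes "k > 0" and g: "\<And>m n. k * (m\<^sup>2 + 1) \<le> n \<Longrightarrow> m ^ a \<le> g n"
  shows "\<forall>\<^sub>F n in sequentially.
    (1 / (2 * sqrt (2 * real k))) ^ a * real n powr (real a / 2) \<le> real (g n)"
  using eventually_ge_at_top[of "8 * k"]
proof eventually_elim
  case n: (elim n)
  define b where "b = sqrt (real n / (2 * real k))"
  define m where "m = nat \<lfloor>b\<rfloor>"
  have "real n / (2 * real k) \<ge> 2\<^sup>2" using n \<open>k > 0\<close> by (simp add: field_simps flip: of_nat_le_iff)
  hence b: "b \<ge> 2" unfolding b_def by (rule real_le_rsqrt)
  have m_le: "real m \<le> b" and m_ge: "b / 2 \<le> real m" and m_pos: "m \<ge> 1"
    using b unfolding m_def by linarith+
  have "(real m)\<^sup>2 \<le> b\<^sup>2" using m_le by (intro power_mono) auto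
  also have "b\<^sup>2 = real n / (2 * real k)" by (simp add: b_def)
  finally have "real (2 * k * m\<^sup>2) \<le> real n" using \<open>k > 0\<close> by (simp add: field_simps)
  hence "2 * k * m\<^sup>2 \<le> n" by (simp only: of_nat_le_iff)
  moreover have "k * (m\<^sup>2 + 1) \<le> k * (2 * m\<^sup>2)" using m_pos by (intro mult_left_mono) auto
  ultimately have size: "k * (m\<^sup>2 + 1) \<le> n" by (simp only: mult.assoc mult.left_commute)
  have "real n powr (real a / 2) = (real n powr (1 / 2)) powr real a"
    unfolding powr_powr by simp
  also have "\<dots> = sqrt (real n) ^ a"
    using n \<open>k > 0\<close> by (subst powr_realpow) (auto simp: powr_half_sqrt)
  finally have "(1 / (2 * sqrt (2 * real k))) ^ a * real n powr (real a / 2) = (b / 2) ^ a"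
    unfolding b_def by (simp only: flip: power_mult_distrib) (simp add: real_sqrt_divide mult.commute)
  also have "\<dots> \<le> real m ^ a" using m_ge b by (intro power_mono) auto
  also have "\<dots> \<le> real (g n)" using g[OF size] by (simp flip: of_nat_power)
  finally show ?case .
qed

theorem theorem5p3:
  fixes p :: nat
  assumes "p > 0"
  shows "\<exists>C::real. C > 0 \<and>
    (\<forall>d\<ge>5. \<forall>\<^sub>F n in sequentially.
       real (max_rips_betti TYPE('k::field) p d n) \<ge> C * real n powr (real p / 2 + 1 / 2))"
proof (intro exI conjI allI impI)
  let ?C = "(1 / (2 * sqrt (2 * real (Suc p)))) ^ Suc p"
  show "?C > 0" by simp
  fix d :: nat assume d: "d \<ge> 5"
  have "\<forall>\<^sub>F n in sequentially.
      ?C * real n powr (real (Suc p) / 2) \<le> real (max_rips_betti TYPE('k) p d n)"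
    using zero_less_Suc power_le_max_rips_betti[OF assms d]
    by (rule eventually_powr_le_of_square_samples)
  moreover have "real (Suc p) / 2 = real p / 2 + 1 / 2" by (simp add: field_simps)
  ultimately show "\<forall>\<^sub>F n in sequentially.
      ?C * real n powr (real p / 2 + 1 / 2) \<le> real (max_rips_betti TYPE('k) p d n)"
    by (simp only:)
qed

end
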